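(* For any $a_0,b_0\in\mathbb R$ with $a_0>b_0$ and any $\dot a_0,\dot b_0\in\,]-1,1[$, there is at least one pair of trajectories $a,b\in C^\infty(\mathbb R)$ such that for all $t\in\mathbb R$ $$\frac{d}{dt}\left(\frac{\dot a(t)}{\sqrt{1-\dot a(t)^2}}\right)=\kappa_a\,\frac{\rho(\dot b(t_2^-))}{(a(t)-b(t_2^-))^2},\qquad \frac{d}{dt}\left(\frac{\dot b(t)}{\sqrt{1-\dot b(t)^2}}\right)=-\kappa_b\,\frac{\sigma(\dot a(t_1^-))}{(b(t)-a(t_1^-))^2},$$ where $t_i^-=t_i^-(a,b,t)$, and $$a(0)=a_0,\quad \dot a(0)=\dot a_0,\quad b(0)=b_0,\quad \dot b(0)=\dot b_0 .$$
   Context: Two like charges (charges $e_a,e_b$ of equal sign, masses $m_a,m_b>0$) move on a straight line; $\kappa_a=e_ae_b/m_a>0$ and $\kappa_b=e_ae_b/m_b>0$ are fixed coupling constants. The speed of light is $1$. Set $\rho(v)=\frac{1+v}{1-v}$, $\sigma(v)=\frac{1-v}{1+v}$ for $v\in\,]-1,1[$. For trajectories $a,b:\mathbb R\to\mathbb R$, the retarded times are defined implicitly by $$t_1^-(a,b,t)=t-|a(t_1^-(a,b,t))-b(t)|,\qquad t_2^-(a,b,t)=t-|a(t)-b(t_2^-(a,b,t))|.$$ That $(a,b)$ satisfies the equations includes that $|\dot a|,|\dot b|<1$ pointwise, that the retarded times exist for all $t$, and that the denominators do not vanish. (These are the Synge equations.) *)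

theory Defs
  imports "HOL-Analysis.Analysis"
begin

text \<open>The class \<open>C\<^sup>\<infinity>(\<real>)\<close>: every iterated derivative exists at every point.\<close>

definition smooth_real :: "(real \<Rightarrow> real) \<Rightarrow> bool" where
  "smooth_real f \<longleftrightarrow> (\<forall>n t. ((deriv ^^ n) f) field_differentiable (at t))"

definition rho :: "real \<Rightarrow> real" where
  "rho v = (1 + v) / (1 - v)"

definition sigma :: "real \<Rightarrow> real" where
  "sigma v = (1 - v) / (1 + v)"

text \<open>
  The implicit equations for the retarded times, as relations between the time \<open>t\<close> and a
  candidate retarded time \<open>s\<close>.
\<close>

definition is_ret1 :: "(real \<Rightarrow> real) \<Rightarrow> (real \<Rightarrow> real) \<Rightarrow> real \<Rightarrow> real \<Rightarrow> bool" where
  "is_ret1 a b t s \<longleftrightarrow> s = t - \<bar>a s - b t\<bar>"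

definition is_ret2 :: "(real \<Rightarrow> real) \<Rightarrow> (real \<Rightarrow> real) \<Rightarrow> real \<Rightarrow> real \<Rightarrow> bool" where
  "is_ret2 a b t s \<longleftrightarrow> s = t - \<bar>a t - b s\<bar>"

definition ret1 :: "(real \<Rightarrow> real) \<Rightarrow> (real \<Rightarrow> real) \<Rightarrow> real \<Rightarrow> real" where
  "ret1 a b t = (THE s. is_ret1 a b t s)"

definition ret2 :: "(real \<Rightarrow> real) \<Rightarrow> (real \<Rightarrow> real) \<Rightarrow> real \<Rightarrow> real" where
  "ret2 a b t = (THE s. is_ret2 a b t s)"

text \<open>
  The Synge equations. \<^const>\<open>ret1\<close> and \<^const>\<open>ret2\<close> carry no information unless the implicit
  equations have exactly one solution, so this is required explicitly; uniqueness is in fact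
  automatic at speeds below 1. The differential equations assert that the momenta are
  differentiable with the stated derivative. The denominators inside \<^const>\<open>rho\<close> and
  \<^const>\<open>sigma\<close> and the square roots are nonzero by the speed bounds.
\<close>

definition synge_solution ::
  "real \<Rightarrow> real \<Rightarrow> (real \<Rightarrow> real) \<Rightarrow> (real \<Rightarrow> real) \<Rightarrow> bool" where
  "synge_solution \<kappa>a \<kappa>b a b \<longleftrightarrow>
     (\<forall>t. \<bar>deriv a t\<bar> < 1 \<and> \<bar>deriv b t\<bar> < 1) \<and>
     (\<forall>t. (\<exists>!s. is_ret1 a b t s) \<and> (\<exists>!s. is_ret2 a b t s)) \<and>
     (\<forall>t. a t - b (ret2 a b t) \<noteq> 0 \<and> b t - a (ret1 a b t) \<noteq> 0) \<and>
     (\<forall>t. ((\<lambda>s. deriv a s / sqrt (1 - (deriv a s)\<^sup>2)) has_real_derivative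
             \<kappa>a * (rho (deriv b (ret2 a b t)) / (a t - b (ret2 a b t))\<^sup>2)) (at t)) \<and>
     (\<forall>t. ((\<lambda>s. deriv b s / sqrt (1 - (deriv b s)\<^sup>2)) has_real_derivative
             - \<kappa>b * (sigma (deriv a (ret1 a b t)) / (b t - a (ret1 a b t))\<^sup>2)) (at t))"

end

theory Submission
  imports Defs "HOL-Complex_Analysis.Great_Picard"
begin

text \<open>
  With \<open>A = a\<close>, \<open>B = - b\<close> and the momenta \<open>\<alpha>\<close>, \<open>\<beta>\<close> of \<open>A\<close> and \<open>B\<close> the problem is symmetric under
  exchange of the particles, both momenta are nondecreasing, and
  \<open>\<alpha>' = \<kappa>\<^sub>a sigma (B' (s)) / R\<^sup>2\<close>, where \<open>R = t - s = A (t) + B (s)\<close> and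
  \<open>s' = (1 - A') / (1 + B' (s))\<close>.

  If the distance \<open>R\<close> is cut off below at \<open>\<delta>\<close> and the momenta at \<open>- P\<close>, then the forces are
  bounded, and a pair of momenta satisfying the equations on the whole line is a fixed point on a
  convex set of equi-Lipschitz functions. It is obtained as a limit of piecewise linear
  functions that are fixed up to \<open>O(1/n)\<close> at the grid points by Kuhn's combinatorial lemma;
  neither a history nor an initial value problem is involved.

  The cutoffs are inactive for suitable \<open>\<delta>\<close> and \<open>P\<close>. The quantity \<open>H = sqrt (1 + \<alpha>\<^sup>2) - \<alpha>\<close>
  satisfies \<open>- H' = \<kappa>\<^sub>a (1 - B' (s)) s' / R\<^sup>2\<close>, and \<open>(1 / R)' = (s' - 1) / R\<^sup>2\<close>. Since these two
  derivatives are comparable, combinations of \<open>H\<close> and \<open>1 / R\<close> are monotone, which bounds \<open>R\<close> from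
  below on the whole line and then \<open>\<alpha>\<close> from below in the past. Smoothness follows by
  bootstrapping the differential equations for \<open>\<alpha>\<close>, \<open>\<beta>\<close> and the retarded times.
\<close>

subsection \<open>Functional differential equations with bounded right-hand side\<close>

definition slopes :: "real \<Rightarrow> real \<Rightarrow> (real \<Rightarrow> real) set" where
  "slopes M c = {f. f 0 = c \<and> (\<forall>s t. s \<le> t \<longrightarrow> 0 \<le> f t - f s \<and> f t - f s \<le> M * (t - s))}"

lemma slopesD:
  assumes "f \<in> slopes M c"
  shows "f 0 = c" "s \<le> t \<Longrightarrow> f s \<le> f t" "\<bar>f t - f s\<bar> \<le> M * \<bar>t - s\<bar>"
proof -
  show "f 0 = c" "s \<le> t \<Longrightarrow> f s \<le> f t" using assms by (auto simp: slopes_def)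
  have *: "0 \<le> f t - f s \<and> f t - f s \<le> M * (t - s)" if "s \<le> t" for s t
    using assms that by (auto simp: slopes_def)
  show "\<bar>f t - f s\<bar> \<le> M * \<bar>t - s\<bar>"
    using *[of s t] *[of t s] by (cases "s \<le> t") auto
qed

lemma slopes_continuous: "f \<in> slopes M c \<Longrightarrow> continuous_on UNIV f"
proof -
  assume f: "f \<in> slopes M c"
  have "(\<bar>M\<bar>)-lipschitz_on UNIV f"
  proof (rule lipschitz_onI)
    fix x y :: real
    have "\<bar>f x - f y\<bar> \<le> M * \<bar>x - y\<bar>" using slopesD(3)[OF f] .
    also have "\<dots> \<le> \<bar>M\<bar> * \<bar>x - y\<bar>" by (intro mult_right_mono) auto
    finally show "dist (f x) (f y) \<le> \<bar>M\<bar> * dist x y" by (simp add: dist_real_def)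
  qed auto
  then show ?thesis by (rule lipschitz_on_continuous_on)
qed

lemma slopes_limit:
  assumes "\<And>n. f n \<in> slopes M c" "\<And>t. (\<lambda>n. f n t) \<longlonglongrightarrow> g t"
  shows "g \<in> slopes M c"
proof -
  have "g 0 = c"
    using assms(2)[of 0] slopesD(1)[OF assms(1)] by (simp add: LIMSEQ_const_iff)
  moreover have "0 \<le> g t - g s \<and> g t - g s \<le> M * (t - s)" if "s \<le> t" for s t
  proof
    have l: "(\<lambda>n. f n t - f n s) \<longlonglongrightarrow> g t - g s" by (intro tendsto_diff assms)
    have "0 \<le> f n t - f n s" "f n t - f n s \<le> M * (t - s)" for n
      using assms(1)[of n] that by (auto simp: slopes_def)
    then show "0 \<le> g t - g s" "g t - g s \<le> M * (t - s)"
      using LIMSEQ_le_const[OF l, of 0] LIMSEQ_le_const2[OF l, of "M * (t - s)"] by auto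
  qed
  ultimately show ?thesis by (auto simp: slopes_def)
qed

text \<open>The common Lipschitz constant upgrades pointwise convergence to convergence along moving
  arguments. In this form delayed values, taken at a varying signal time, pass to the limit.\<close>

lemma slopes_tendsto:
  assumes "\<And>n. f n \<in> slopes M c" "\<And>t. (\<lambda>n. f n t) \<longlonglongrightarrow> g t" "\<tau> \<longlonglongrightarrow> t"
  shows "(\<lambda>n. f n (\<tau> n)) \<longlonglongrightarrow> g t"
proof -
  have "(\<lambda>n. M * \<bar>\<tau> n - t\<bar>) \<longlonglongrightarrow> M * \<bar>t - t\<bar>" by (intro tendsto_intros assms)
  then have z: "(\<lambda>n. M * \<bar>\<tau> n - t\<bar>) \<longlonglongrightarrow> 0" by simp
  have "(\<lambda>n. f n (\<tau> n) - f n t) \<longlonglongrightarrow> 0"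
    by (rule Lim_null_comparison[OF always_eventually z]) (simp add: slopesD(3)[OF assms(1)])
  from tendsto_add[OF this assms(2)[of t]] show ?thesis by simp
qed

text \<open>Arzela-Ascoli argument: a diagonal sequence converges at all rational times, and the
  common Lipschitz constant carries the Cauchy property to every real time.\<close>

lemma slopes_convergent_subsequence:
  assumes "\<And>n k. k \<in> I \<Longrightarrow> f n k \<in> slopes M (c k)" "countable I"
  obtains r g where "strict_mono (r :: nat \<Rightarrow> nat)"
    "\<And>k t. k \<in> I \<Longrightarrow> (\<lambda>n. f (r n) k t) \<longlonglongrightarrow> g k t"
proof -
  define b where "b = (\<lambda>(k, t). 1 + \<bar>c k\<bar> + \<bar>M\<bar> * \<bar>t\<bar>)"
  define F where "F = (\<lambda>n (k, t). f n k t / b (k, t))"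
  have bpos: "b x > 0" for x by (cases x) (auto simp: b_def intro!: add_pos_nonneg)
  have bd: "\<bar>f n k t\<bar> \<le> b (k, t)" if "k \<in> I" for n k t
  proof -
    have "\<bar>f n k t - f n k 0\<bar> \<le> M * \<bar>t - 0\<bar>" using slopesD(3)[OF assms(1)[OF that]] .
    also have "M * \<bar>t - 0\<bar> \<le> \<bar>M\<bar> * \<bar>t\<bar>" by (simp add: mult_right_mono)
    finally show ?thesis using slopesD(1)[OF assms(1)[OF that, of n]] by (auto simp: b_def)
  qed
  have "norm (F n x) \<le> 1" if "x \<in> I \<times> \<rat>" for n x
    using bd bpos[of x] that by (cases x) (auto simp: F_def field_simps)
  moreover have "countable (I \<times> \<rat>)" using assms(2) countable_rat by blast
  ultimately obtain r where r: "strict_mono r"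
      "\<And>x. x \<in> I \<times> \<rat> \<Longrightarrow> \<exists>l. (\<lambda>n. F (r n) x) \<longlonglongrightarrow> l"
    using function_convergent_subsequence[of "I \<times> \<rat>" F 1] by metis
  have "convergent (\<lambda>n. f (r n) k t)" if k: "k \<in> I" for k t
  proof (rule Cauchy_convergent, rule metric_CauchyI)
    fix e :: real assume e: "e > 0"
    obtain q where q: "q \<in> \<rat>" "\<bar>t - q\<bar> * (\<bar>M\<bar> + 1) < e / 3"
    proof -
      have "t < t + e / 3 / (\<bar>M\<bar> + 1)" using e by (simp add: divide_pos_pos add_nonneg_pos)
      then obtain q where "q \<in> \<rat>" "t < q" "q < t + e / 3 / (\<bar>M\<bar> + 1)" using Rats_dense_in_real by blast
      then have "\<bar>t - q\<bar> < e / 3 / (\<bar>M\<bar> + 1)" by auto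
      then have "\<bar>t - q\<bar> * (\<bar>M\<bar> + 1) < e / 3"
        by (subst (asm) pos_less_divide_eq) (auto intro: add_nonneg_pos)
      with \<open>q \<in> \<rat>\<close> show ?thesis using that by blast
    qed
    obtain l where "(\<lambda>n. F (r n) (k, q)) \<longlonglongrightarrow> l" using r(2) k q by blast
    from tendsto_mult_right[OF this, of "b (k, q)"] have "(\<lambda>n. f (r n) k q) \<longlonglongrightarrow> l * b (k, q)"
      using bpos[of "(k, q)"] by (simp add: F_def)
    then have "Cauchy (\<lambda>n. f (r n) k q)" by (rule LIMSEQ_imp_Cauchy)
    then obtain N where N: "\<And>m n. m \<ge> N \<Longrightarrow> n \<ge> N \<Longrightarrow> \<bar>f (r m) k q - f (r n) k q\<bar> < e / 3"
      using e unfolding Cauchy_def dist_real_def by (meson divide_pos_pos zero_less_numeral)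
    have close: "\<bar>f n k t - f n k q\<bar> < e / 3" for n
    proof -
      have "\<bar>f n k t - f n k q\<bar> \<le> M * \<bar>t - q\<bar>" using slopesD(3)[OF assms(1)[OF k]] .
      also have "\<dots> \<le> \<bar>t - q\<bar> * (\<bar>M\<bar> + 1)" by (subst mult.commute, intro mult_left_mono) auto
      finally show ?thesis using q by linarith
    qed
    have "\<bar>f (r m) k t - f (r n) k t\<bar> < e" if "m \<ge> N" "n \<ge> N" for m n
      using close[of "r m"] close[of "r n"] N[OF that] by linarith
    then show "\<exists>N. \<forall>m\<ge>N. \<forall>n\<ge>N. dist (f (r m) k t) (f (r n) k t) < e"
      by (auto simp: dist_real_def)
  qed
  then have "\<And>k t. k \<in> I \<Longrightarrow> (\<lambda>n. f (r n) k t) \<longlonglongrightarrow> lim (\<lambda>n. f (r n) k t)"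
    by (simp add: convergent_LIMSEQ_iff)
  with r(1) show ?thesis by (rule that[where g = "\<lambda>k t. lim (\<lambda>n. f (r n) k t)"])
qed

section \<open>Piecewise linear functions with prescribed slopes\<close>

definition grid :: "nat \<Rightarrow> nat \<Rightarrow> real" where
  "grid n i = (real i - (real n)\<^sup>2) / real n"

text \<open>As a function of \<open>t\<close> this has slope 1 on the \<open>i\<close>-th grid cell and slope 0 elsewhere.\<close>

definition ramp :: "nat \<Rightarrow> nat \<Rightarrow> real \<Rightarrow> real" where
  "ramp n i t = min (grid n (Suc i)) t - min (grid n i) t"

text \<open>The points \<open>grid n i\<close> with \<open>i \<le> 2 * n^2\<close> cut the interval
  from \<open>- n\<close> to \<open>n\<close> into cells of length \<open>1 / n\<close>. The
  parameters \<open>g\<close> are slopes on these cells rather than values at the nodes, so that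
  membership in \<open>slopes M c\<close> becomes a box constraint. Outside the interval the
  function is constant.\<close>

definition polyline :: "nat \<Rightarrow> real \<Rightarrow> (nat \<Rightarrow> real) \<Rightarrow> real \<Rightarrow> real" where
  "polyline n c g t = c + (\<Sum>i<2 * n\<^sup>2. g i * (ramp n i t - ramp n i 0))"

lemma grid_Suc: "n > 0 \<Longrightarrow> grid n (Suc i) = grid n i + 1 / real n"
  by (simp add: grid_def field_simps)

lemma ramp_mono:
  assumes "n > 0" "s \<le> t"
  shows "ramp n i s \<le> ramp n i t"
proof -
  obtain d where d: "d \<ge> 0" "grid n (Suc i) = grid n i + d"
    using grid_Suc[OF assms(1)] by (metis of_nat_0_le_iff zero_le_divide_1_iff)
  show ?thesis using assms(2) d(1) unfolding ramp_def d(2) by linarith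
qed

lemma ramp_const:
  assumes "n > 0" "s \<le> t" "t \<le> grid n i \<or> grid n i + 1 / real n \<le> s"
  shows "ramp n i t = ramp n i s"
proof -
  obtain d where d: "d \<ge> 0" "grid n (Suc i) = grid n i + d" "d = 1 / real n"
    using grid_Suc[OF assms(1)] by simp
  show ?thesis using assms(2,3) d(1) unfolding ramp_def d(2) d(3)[symmetric] by linarith
qed

lemma sum_ramp:
  assumes "n > 0"
  shows "(\<Sum>i<2 * n\<^sup>2. ramp n i t - ramp n i s) =
    (min (real n) t - min (- real n) t) - (min (real n) s - min (- real n) s)"
proof -
  have "(\<Sum>i<2 * n\<^sup>2. ramp n i u) = min (real n) u - min (- real n) u" for u
    using assms
    unfolding ramp_def sum_lessThan_telescope[where f = "\<lambda>i. min (grid n i) u"]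
    by (simp add: grid_def power2_eq_square)
  then show ?thesis by (simp add: sum_subtractf)
qed

lemma sum_ramp_le:
  assumes "n > 0" "s \<le> t"
  shows "(\<Sum>i<2 * n\<^sup>2. ramp n i t - ramp n i s) \<le> t - s"
  using assms by (auto simp: sum_ramp min_def)

lemma polyline_diff:
  "polyline n c g t - polyline n c g s = (\<Sum>i<2 * n\<^sup>2. g i * (ramp n i t - ramp n i s))"
  by (simp add: polyline_def sum_subtractf[symmetric] algebra_simps)

lemma polyline_slopes:
  assumes n: "n > 0" and g: "\<And>i. i < 2 * n\<^sup>2 \<Longrightarrow> 0 \<le> g i \<and> g i \<le> M" and "M \<ge> 0"
  shows "polyline n c g \<in> slopes M c"
proof -
  have "0 \<le> polyline n c g t - polyline n c g s \<and> polyline n c g t - polyline n c g s \<le> M * (t - s)"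
    if st: "s \<le> t" for s t
  proof
    have r: "0 \<le> ramp n i t - ramp n i s" for i using ramp_mono[OF n st, of i] by simp
    show "0 \<le> polyline n c g t - polyline n c g s"
      unfolding polyline_diff using g r by (intro sum_nonneg mult_nonneg_nonneg) auto
    have "polyline n c g t - polyline n c g s \<le> (\<Sum>i<2 * n\<^sup>2. M * (ramp n i t - ramp n i s))"
      unfolding polyline_diff using g r by (intro sum_mono mult_right_mono) auto
    also have "\<dots> = M * (\<Sum>i<2 * n\<^sup>2. ramp n i t - ramp n i s)" by (simp add: sum_distrib_left)
    also have "\<dots> \<le> M * (t - s)" using sum_ramp_le[OF n st] \<open>M \<ge> 0\<close> by (rule mult_left_mono)
    finally show "polyline n c g t - polyline n c g s \<le> M * (t - s)" .
  qed
  then show ?thesis by (auto simp: slopes_def polyline_def)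
qed

text \<open>The ramp increments between 0 and \<open>t\<close> add up to at most
  \<open>\<bar>t\<bar>\<close> in absolute value, so the estimate does not deteriorate with the
  number of cells.\<close>

lemma polyline_close:
  assumes n: "n > 0" and g: "\<And>i. i < 2 * n\<^sup>2 \<Longrightarrow> \<bar>g i - g' i\<bar> \<le> e" and "e \<ge> 0"
  shows "\<bar>polyline n c g t - polyline n c g' t\<bar> \<le> e * \<bar>t\<bar>"
proof -
  have "polyline n c g t - polyline n c g' t = (\<Sum>i<2 * n\<^sup>2. (g i - g' i) * (ramp n i t - ramp n i 0))"
    by (simp add: polyline_def sum_subtractf[symmetric] algebra_simps)
  also have "\<bar>\<dots>\<bar> \<le> (\<Sum>i<2 * n\<^sup>2. \<bar>g i - g' i\<bar> * \<bar>ramp n i t - ramp n i 0\<bar>)"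
    by (rule order_trans[OF sum_abs]) (simp add: abs_mult)
  also have "\<dots> \<le> (\<Sum>i<2 * n\<^sup>2. e * \<bar>ramp n i t - ramp n i 0\<bar>)"
    using g by (intro sum_mono mult_right_mono) auto
  also have "\<dots> = e * (\<Sum>i<2 * n\<^sup>2. \<bar>ramp n i t - ramp n i 0\<bar>)" by (simp add: sum_distrib_left)
  also have "(\<Sum>i<2 * n\<^sup>2. \<bar>ramp n i t - ramp n i 0\<bar>) \<le> \<bar>t\<bar>"
  proof (cases "0 \<le> t")
    case True
    then show ?thesis using sum_ramp_le[OF n True] ramp_mono[OF n True] by simp
  next
    case False
    then have "t \<le> 0" by simp
    then have "\<bar>ramp n i t - ramp n i 0\<bar> = ramp n i 0 - ramp n i t" for i
      using ramp_mono[OF n \<open>t \<le> 0\<close>, of i] by simp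
    then show ?thesis using sum_ramp_le[OF n \<open>t \<le> 0\<close>] False by simp
  qed
  finally show ?thesis using \<open>e \<ge> 0\<close> by (simp add: mult_left_mono)
qed

section \<open>Approximate fixed points\<close>

text \<open>Kuhn's lemma is the combinatorial core of Brouwer's theorem. For each coordinate it
  yields two nearby slope vectors, one with slope at most the force and one with slope at least the
  force. Hence there are two families \<open>\<rho>\<close> and \<open>\<sigma>\<close>, which may
  vary with the coordinate; continuity of \<open>F\<close> merges the inequalities in the
  limit.\<close>

lemma approximate_solution:
  fixes F :: "(nat \<Rightarrow> real \<Rightarrow> real) \<Rightarrow> nat \<Rightarrow> real \<Rightarrow> real"
  assumes n: "n > 0" and M: "M > 0"
    and F: "\<And>\<gamma> k t. (\<And>l. l < m \<Longrightarrow> \<gamma> l \<in> slopes M (c l)) \<Longrightarrow> k < m \<Longrightarrow> 0 \<le> F \<gamma> k t \<and> F \<gamma> k t \<le> M"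
  shows "\<exists>g. (\<forall>k<m. polyline n (c k) (g k) \<in> slopes M (c k)) \<and>
    (\<forall>k<m. \<forall>i<2 * n\<^sup>2. \<exists>\<rho> \<sigma>.
       (\<forall>l<m. \<rho> l \<in> slopes M (c l) \<and> \<sigma> l \<in> slopes M (c l) \<and>
          (\<forall>t. \<bar>\<rho> l t - polyline n (c l) (g l) t\<bar> \<le> M / n * \<bar>t\<bar> \<and>
               \<bar>\<sigma> l t - polyline n (c l) (g l) t\<bar> \<le> M / n * \<bar>t\<bar>)) \<and>
       g k i \<le> F \<rho> k (grid n i) \<and> F \<sigma> k (grid n i) \<le> g k i + M / n)"
proof -
  define N where "N = 2 * n\<^sup>2"
  \<comment> \<open>Kuhn's lemma works with integer points of a cube: coordinate
    \<open>m * i + k\<close> encodes the slope of the \<open>k\<close>-th function on the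
    \<open>i\<close>-th cell, in units of \<open>M / n\<close>.\<close>
  define G where "G = (\<lambda>(x :: nat \<Rightarrow> nat) k i. M * real (x (m * i + k)) / n)"
  define \<Gamma> where "\<Gamma> = (\<lambda>x k. polyline n (c k) (G x k))"
  \<comment> \<open>Label 0 records that the slope is at most the force, label 1 that it is at least
    the force. The faces \<open>x j = 0\<close> and \<open>x j = n\<close> get the labels that
    Kuhn's lemma prescribes; this is consistent because \<open>F\<close> lies between 0 and
    \<open>M\<close>.\<close>
  define label where "label = (\<lambda>x j. if x j = 0 \<or> (x j \<noteq> n \<and> M * real (x j) / n \<le> F (\<Gamma> x) (j mod m) (grid n (j div m)))
     then 0 else 1 :: nat)"
  have idx: "m * i + k < m * N" if "k < m" "i < N" for k i
  proof -
    have "m * i + k < m * (i + 1)" using that by simp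
    also have "\<dots> \<le> m * N" using that by (intro mult_left_mono) auto
    finally show ?thesis .
  qed
  have sl: "\<Gamma> x k \<in> slopes M (c k)" if "k < m" "\<forall>j<m * N. x j \<le> n" for x k
    unfolding \<Gamma>_def
  proof (rule polyline_slopes[OF n])
    fix i assume "i < 2 * n\<^sup>2"
    then have "x (m * i + k) \<le> n" using that idx[of k i] by (auto simp: N_def)
    then show "0 \<le> G x k i \<and> G x k i \<le> M" using n M by (simp add: G_def field_simps)
  qed (use M in auto)
  obtain q where q: "\<forall>j<m * N. q j < n"
    and rs: "\<forall>i<m * N. \<exists>r s. (\<forall>j<m * N. q j \<le> r j \<and> r j \<le> q j + 1) \<and>
      (\<forall>j<m * N. q j \<le> s j \<and> s j \<le> q j + 1) \<and> label r i \<noteq> label s i"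
    by (rule kuhn_lemma[of n "m * N" label]) (use n in \<open>auto simp: label_def\<close>)
  have "\<exists>\<rho> \<sigma>. (\<forall>l<m. \<rho> l \<in> slopes M (c l) \<and> \<sigma> l \<in> slopes M (c l) \<and>
          (\<forall>t. \<bar>\<rho> l t - \<Gamma> q l t\<bar> \<le> M / n * \<bar>t\<bar> \<and> \<bar>\<sigma> l t - \<Gamma> q l t\<bar> \<le> M / n * \<bar>t\<bar>)) \<and>
       G q k i \<le> F \<rho> k (grid n i) \<and> F \<sigma> k (grid n i) \<le> G q k i + M / n"
    if k: "k < m" and i: "i < N" for k i
  proof -
    let ?j = "m * i + k"
    have j: "?j < m * N" using idx[OF k i] .
    have jm: "?j mod m = k" "?j div m = i" using k by auto
    obtain r s where r: "\<forall>j<m * N. q j \<le> r j \<and> r j \<le> q j + 1"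
      and s: "\<forall>j<m * N. q j \<le> s j \<and> s j \<le> q j + 1"
      and lab: "label r ?j = 0" "label s ?j = 1"
    proof -
      obtain r s where *: "\<forall>j<m * N. q j \<le> r j \<and> r j \<le> q j + 1"
          "\<forall>j<m * N. q j \<le> s j \<and> s j \<le> q j + 1" "label r ?j \<noteq> label s ?j"
        using rs j by blast
      then have "label r ?j = 0 \<and> label s ?j = 1 \<or> label r ?j = 1 \<and> label s ?j = 0"
        by (auto simp: label_def split: if_splits)
      then show ?thesis using * that by blast
    qed
    have le: "\<forall>j<m * N. x j \<le> n" if "\<forall>j<m * N. q j \<le> x j \<and> x j \<le> q j + 1" for x
      using that q by (metis Suc_eq_plus1 Suc_leI order_trans)
    have close: "\<bar>\<Gamma> x l t - \<Gamma> q l t\<bar> \<le> M / n * \<bar>t\<bar>"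
      if "\<forall>j<m * N. q j \<le> x j \<and> x j \<le> q j + 1" "l < m" for x l t
      unfolding \<Gamma>_def
    proof (rule polyline_close[OF n])
      fix i assume "i < 2 * n\<^sup>2"
      then have "q (m * i + l) \<le> x (m * i + l) \<and> x (m * i + l) \<le> q (m * i + l) + 1"
        using that idx[of l i] by (auto simp: N_def)
      then have "\<bar>real (x (m * i + l)) - real (q (m * i + l))\<bar> \<le> 1" by linarith
      then have "M / n * \<bar>real (x (m * i + l)) - real (q (m * i + l))\<bar> \<le> M / n * 1"
        using M by (intro mult_left_mono) auto
      moreover have "\<bar>G x l i - G q l i\<bar> = M / n * \<bar>real (x (m * i + l)) - real (q (m * i + l))\<bar>"
      proof -
        have "G x l i - G q l i = M / n * (real (x (m * i + l)) - real (q (m * i + l)))"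
          by (simp add: G_def diff_divide_distrib right_diff_distrib)
        then show ?thesis using M by (simp add: abs_mult)
      qed
      ultimately show "\<bar>G x l i - G q l i\<bar> \<le> M / n" by simp
    qed (use M in auto)
    have "0 \<le> F (\<Gamma> r) k (grid n i)" using F[OF sl[OF _ le[OF r]] k] by simp
    then have 1: "M * real (r ?j) / n \<le> F (\<Gamma> r) k (grid n i)"
      using lab(1) jm n q j r by (auto simp: label_def split: if_splits)
    have "F (\<Gamma> s) k (grid n i) \<le> M" using F[OF sl[OF _ le[OF s]] k] by simp
    then have 2: "F (\<Gamma> s) k (grid n i) \<le> M * real (s ?j) / n"
      using lab(2) jm n by (auto simp: label_def split: if_splits)
    have "M * real (q ?j) / n \<le> M * real (r ?j) / n"
      using r j M by (intro divide_right_mono mult_left_mono) auto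
    with 1 have 3: "G q k i \<le> F (\<Gamma> r) k (grid n i)" by (simp add: G_def)
    have "real (s ?j) \<le> real (q ?j) + 1" using s j by (metis of_nat_1 of_nat_add of_nat_mono)
    then have "M * real (s ?j) / n \<le> M * (real (q ?j) + 1) / n"
      using M by (intro divide_right_mono mult_left_mono) auto
    also have "\<dots> = G q k i + M / n" by (simp add: G_def add_divide_distrib distrib_left)
    finally have 4: "F (\<Gamma> s) k (grid n i) \<le> G q k i + M / n" using 2 by simp
    show ?thesis
      by (intro exI[of _ "\<Gamma> r"] exI[of _ "\<Gamma> s"] conjI allI impI sl le close r s 3 4)
  qed
  moreover have "\<Gamma> q k \<in> slopes M (c k)" if "k < m" for k
    using sl[OF that] q less_imp_le by blast
  ultimately show ?thesis
    unfolding \<Gamma>_def N_def by (intro exI[of _ "G q"]) simp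
qed

section \<open>Passage to the limit\<close>

text \<open>The two conditions on \<open>grid n i\<close> say that the cell overlaps the interval
  from \<open>s\<close> to \<open>t\<close>. The other ramps are constant there and all increments
  add up to \<open>t - s\<close>, so the increment is a weighted sum of slopes near
  \<open>D\<close>.\<close>

lemma polyline_increment:
  assumes n: "n > 0" and st: "s \<le> t" "\<bar>s\<bar> \<le> n" "\<bar>t\<bar> \<le> n"
    and g: "\<And>i. i < 2 * n\<^sup>2 \<Longrightarrow> grid n i < t \<Longrightarrow> s < grid n i + 1 / n \<Longrightarrow> \<bar>g i - D\<bar> \<le> e"
  shows "\<bar>polyline n c g t - polyline n c g s - D * (t - s)\<bar> \<le> e * (t - s)"
proof -
  have full: "(\<Sum>i<2 * n\<^sup>2. ramp n i t - ramp n i s) = t - s"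
    using st unfolding sum_ramp[OF n] by auto
  have "polyline n c g t - polyline n c g s - D * (t - s) =
      (\<Sum>i<2 * n\<^sup>2. g i * (ramp n i t - ramp n i s)) - D * (\<Sum>i<2 * n\<^sup>2. ramp n i t - ramp n i s)"
    by (simp only: full polyline_diff)
  also have "\<dots> = (\<Sum>i<2 * n\<^sup>2. (g i - D) * (ramp n i t - ramp n i s))"
    unfolding sum_distrib_left sum_subtractf[symmetric] by (simp add: left_diff_distrib)
  also have "\<bar>\<dots>\<bar> \<le> (\<Sum>i<2 * n\<^sup>2. e * (ramp n i t - ramp n i s))"
  proof (rule order_trans[OF sum_abs sum_mono])
    fix i assume i: "i \<in> {..<2 * n\<^sup>2}"
    have r: "0 \<le> ramp n i t - ramp n i s" using ramp_mono[OF n st(1), of i] by simp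
    show "\<bar>(g i - D) * (ramp n i t - ramp n i s)\<bar> \<le> e * (ramp n i t - ramp n i s)"
    proof (cases "grid n i < t \<and> s < grid n i + 1 / n")
      case True
      then have "\<bar>g i - D\<bar> \<le> e" using g i by simp
      then show ?thesis using r by (simp add: abs_mult mult_right_mono)
    next
      case False
      then have "ramp n i t - ramp n i s = 0" using ramp_const[OF n st(1), of i] by auto
      then show ?thesis by simp
    qed
  qed
  also have "\<dots> = e * (t - s)" by (simp only: full sum_distrib_left[symmetric])
  finally show ?thesis .
qed

text \<open>The derivative of a limit of approximate solutions is read off from the increments of
  the polylines, whose slopes near \<open>t\<close> are eventually close to
  \<open>F \<gamma> k t\<close>. Continuity is required jointly in the functions and in time because
  the grid points move too.\<close>

theorem functional_ode_solution:
  fixes F :: "(nat \<Rightarrow> real \<Rightarrow> real) \<Rightarrow> nat \<Rightarrow> real \<Rightarrow> real"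
  assumes M: "M > 0"
    and F: "\<And>\<gamma> k t. (\<And>l. l < m \<Longrightarrow> \<gamma> l \<in> slopes M (c l)) \<Longrightarrow> k < m \<Longrightarrow> 0 \<le> F \<gamma> k t \<and> F \<gamma> k t \<le> M"
    and cont: "\<And>\<Gamma> \<gamma> \<tau> k t. (\<And>n l. l < m \<Longrightarrow> \<Gamma> n l \<in> slopes M (c l)) \<Longrightarrow>
      (\<And>l t. l < m \<Longrightarrow> (\<lambda>n. \<Gamma> n l t) \<longlonglongrightarrow> \<gamma> l t) \<Longrightarrow> \<tau> \<longlonglongrightarrow> t \<Longrightarrow> k < m \<Longrightarrow>
      (\<lambda>n. F (\<Gamma> n) k (\<tau> n)) \<longlonglongrightarrow> F \<gamma> k t"
  obtains \<gamma> where "\<And>k. k < m \<Longrightarrow> \<gamma> k \<in> slopes M (c k)"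
    "\<And>k t. k < m \<Longrightarrow> (\<gamma> k has_real_derivative F \<gamma> k t) (at t)"
proof -
  let ?S = "\<lambda>n. Suc n"
  have "\<forall>n. \<exists>g. (\<forall>k<m. polyline (?S n) (c k) (g k) \<in> slopes M (c k)) \<and>
    (\<forall>k<m. \<forall>i<2 * (?S n)\<^sup>2. \<exists>\<rho> \<sigma>.
       (\<forall>l<m. \<rho> l \<in> slopes M (c l) \<and> \<sigma> l \<in> slopes M (c l) \<and>
          (\<forall>t. \<bar>\<rho> l t - polyline (?S n) (c l) (g l) t\<bar> \<le> M / ?S n * \<bar>t\<bar> \<and>
               \<bar>\<sigma> l t - polyline (?S n) (c l) (g l) t\<bar> \<le> M / ?S n * \<bar>t\<bar>)) \<and>
       g k i \<le> F \<rho> k (grid (?S n) i) \<and> F \<sigma> k (grid (?S n) i) \<le> g k i + M / ?S n)"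
    using approximate_solution[of "Suc _" M m c F, OF _ M F] by simp
  then obtain g where g1: "\<And>n k. k < m \<Longrightarrow> polyline (?S n) (c k) (g n k) \<in> slopes M (c k)"
    and g2: "\<And>n k i. k < m \<Longrightarrow> i < 2 * (?S n)\<^sup>2 \<Longrightarrow> \<exists>\<rho> \<sigma>.
       (\<forall>l<m. \<rho> l \<in> slopes M (c l) \<and> \<sigma> l \<in> slopes M (c l) \<and>
          (\<forall>t. \<bar>\<rho> l t - polyline (?S n) (c l) (g n l) t\<bar> \<le> M / ?S n * \<bar>t\<bar> \<and>
               \<bar>\<sigma> l t - polyline (?S n) (c l) (g n l) t\<bar> \<le> M / ?S n * \<bar>t\<bar>)) \<and>
       g n k i \<le> F \<rho> k (grid (?S n) i) \<and> F \<sigma> k (grid (?S n) i) \<le> g n k i + M / ?S n"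
    by metis
  define \<Gamma> where "\<Gamma> = (\<lambda>n k. polyline (?S n) (c k) (g n k))"
  obtain r \<gamma> where r: "strict_mono r" and lim: "\<And>k t. k < m \<Longrightarrow> (\<lambda>n. \<Gamma> (r n) k t) \<longlonglongrightarrow> \<gamma> k t"
    using slopes_convergent_subsequence[of "{..<m}" \<Gamma> M c] g1 by (auto simp: \<Gamma>_def)
  have rge: "n \<le> r n" for n using r by (rule strict_mono_imp_increasing)
  have \<gamma>: "\<gamma> k \<in> slopes M (c k)" if "k < m" for k
    using slopes_limit[of "\<lambda>n. \<Gamma> (r n) k" M "c k" "\<gamma> k"] g1 lim that by (auto simp: \<Gamma>_def)
  \<comment> \<open>The slopes on cells near \<open>t\<close> are uniformly close to the limiting
    force. Otherwise there are bad cells at grid points tending to \<open>t\<close>; the perturbed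
    families belonging to them converge to \<open>\<gamma>\<close>, and their forces squeeze the
    slopes to \<open>F \<gamma> k t\<close>.\<close>
  have key: "\<exists>\<eta>>0. \<exists>n0. \<forall>n\<ge>n0. \<forall>i<2 * (?S (r n))\<^sup>2.
      \<bar>grid (?S (r n)) i - t\<bar> \<le> \<eta> \<longrightarrow> \<bar>g (r n) k i - F \<gamma> k t\<bar> \<le> e"
    if k: "k < m" and e: "e > 0" for k t e
  proof (rule ccontr)
    assume neg: "\<not> ?thesis"
    have "\<exists>n i. n \<ge> j \<and> i < 2 * (?S (r n))\<^sup>2 \<and> \<bar>grid (?S (r n)) i - t\<bar> \<le> 1 / Suc j \<and>
        \<not> \<bar>g (r n) k i - F \<gamma> k t\<bar> \<le> e" for j
    proof (rule ccontr)
      assume "\<not> ?thesis"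
      then have "\<forall>n\<ge>j. \<forall>i<2 * (?S (r n))\<^sup>2.
          \<bar>grid (?S (r n)) i - t\<bar> \<le> 1 / Suc j \<longrightarrow> \<bar>g (r n) k i - F \<gamma> k t\<bar> \<le> e" by blast
      moreover have "1 / real (Suc j) > 0" by simp
      ultimately show False using neg by blast
    qed
    then obtain n i where ni: "\<And>j. n j \<ge> j" "\<And>j. i j < 2 * (?S (r (n j)))\<^sup>2"
      "\<And>j. \<bar>grid (?S (r (n j))) (i j) - t\<bar> \<le> 1 / Suc j"
      "\<And>j. \<not> \<bar>g (r (n j)) k (i j) - F \<gamma> k t\<bar> \<le> e"
      by metis
    define \<tau> where "\<tau> = (\<lambda>j. grid (?S (r (n j))) (i j))"
    have inv0: "(\<lambda>j. C / real (Suc j)) \<longlonglongrightarrow> 0" for C :: real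
      using tendsto_mult[OF tendsto_const[of C] LIMSEQ_inverse_real_of_nat]
      by (simp add: divide_inverse)
    have "(\<lambda>j. \<tau> j - t) \<longlonglongrightarrow> 0"
      by (rule Lim_null_comparison[OF always_eventually inv0[of 1]])
         (use ni(3) in \<open>simp add: \<tau>_def\<close>)
    then have \<tau>: "\<tau> \<longlonglongrightarrow> t" by (simp add: LIM_zero_iff)
    have nj: "Suc j \<le> Suc (r (n j))" for j using rge[of "n j"] ni(1)[of j] by simp
    have small: "C / Suc (r (n j)) \<le> C / Suc j" if "C \<ge> 0" for C :: real and j
      using nj[of j] that by (intro divide_left_mono mult_pos_pos) auto
    have filt: "filterlim n at_top sequentially"
      using ni(1) by (intro filterlim_at_top_mono[OF filterlim_ident]) auto
    obtain \<rho> \<sigma> where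
      \<rho>: "\<And>j l. l < m \<Longrightarrow> \<rho> j l \<in> slopes M (c l)"
         "\<And>j l t. l < m \<Longrightarrow> \<bar>\<rho> j l t - \<Gamma> (r (n j)) l t\<bar> \<le> M / Suc (r (n j)) * \<bar>t\<bar>"
         "\<And>j. g (r (n j)) k (i j) \<le> F (\<rho> j) k (\<tau> j)"
      and \<sigma>: "\<And>j l. l < m \<Longrightarrow> \<sigma> j l \<in> slopes M (c l)"
         "\<And>j l t. l < m \<Longrightarrow> \<bar>\<sigma> j l t - \<Gamma> (r (n j)) l t\<bar> \<le> M / Suc (r (n j)) * \<bar>t\<bar>"
         "\<And>j. F (\<sigma> j) k (\<tau> j) \<le> g (r (n j)) k (i j) + M / Suc (r (n j))"
    proof -
      define Q where "Q = (\<lambda>j \<rho> \<sigma>. (\<forall>l<m. \<rho> l \<in> slopes M (c l) \<and> \<sigma> l \<in> slopes M (c l) \<and>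
          (\<forall>t. \<bar>\<rho> l t - \<Gamma> (r (n j)) l t\<bar> \<le> M / Suc (r (n j)) * \<bar>t\<bar> \<and>
               \<bar>\<sigma> l t - \<Gamma> (r (n j)) l t\<bar> \<le> M / Suc (r (n j)) * \<bar>t\<bar>)) \<and>
         g (r (n j)) k (i j) \<le> F \<rho> k (\<tau> j) \<and> F \<sigma> k (\<tau> j) \<le> g (r (n j)) k (i j) + M / Suc (r (n j)))"
      have "\<forall>j. \<exists>\<rho> \<sigma>. Q j \<rho> \<sigma>"
        using g2[OF k ni(2)] unfolding Q_def \<Gamma>_def \<tau>_def by blast
      then obtain \<rho> \<sigma> where "\<forall>j. Q j (\<rho> j) (\<sigma> j)" by metis
      then have "\<And>j. Q j (\<rho> j) (\<sigma> j)" by blast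
      note Q = this[unfolded Q_def]
      show ?thesis by (rule that[of \<rho> \<sigma>]) (use Q in blast)+
    qed
    have conv: "(\<lambda>j. F (\<rho> j) k (\<tau> j)) \<longlonglongrightarrow> F \<gamma> k t"
      if sl: "\<And>j l. l < m \<Longrightarrow> \<rho> j l \<in> slopes M (c l)"
        and cl: "\<And>j l t. l < m \<Longrightarrow> \<bar>\<rho> j l t - \<Gamma> (r (n j)) l t\<bar> \<le> M / Suc (r (n j)) * \<bar>t\<bar>" for \<rho>
    proof (rule cont[OF sl _ \<tau> k])
      fix l u assume l: "l < m"
      have "\<bar>\<rho> j l u - \<Gamma> (r (n j)) l u\<bar> \<le> (M * \<bar>u\<bar>) / Suc j" for j
        using order_trans[OF cl[OF l, of j u]] small[of "M * \<bar>u\<bar>" j] M by simp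
      then have "(\<lambda>j. \<rho> j l u - \<Gamma> (r (n j)) l u) \<longlonglongrightarrow> 0"
        by (intro Lim_null_comparison[OF always_eventually inv0]) auto
      moreover have "(\<lambda>j. \<Gamma> (r (n j)) l u) \<longlonglongrightarrow> \<gamma> l u"
        using filterlim_compose[OF lim[OF l] filt] .
      ultimately have "(\<lambda>j. \<rho> j l u - \<Gamma> (r (n j)) l u + \<Gamma> (r (n j)) l u) \<longlonglongrightarrow> 0 + \<gamma> l u"
        by (rule tendsto_add)
      then show "(\<lambda>j. \<rho> j l u) \<longlonglongrightarrow> \<gamma> l u" by simp
    qed auto
    have "\<forall>\<^sub>F j in sequentially. \<bar>F (\<rho> j) k (\<tau> j) - F \<gamma> k t\<bar> < e / 2"
      using tendstoD[OF conv[OF \<rho>(1,2)], of "e / 2"] e by (simp add: dist_real_def)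
    moreover have "\<forall>\<^sub>F j in sequentially. \<bar>F (\<sigma> j) k (\<tau> j) - F \<gamma> k t\<bar> < e / 2"
      using tendstoD[OF conv[OF \<sigma>(1,2)], of "e / 2"] e by (simp add: dist_real_def)
    moreover have "\<forall>\<^sub>F j in sequentially. \<bar>M / Suc j\<bar> < e / 2"
      using tendstoD[OF inv0[of M], of "e / 2"] e by (simp add: dist_real_def)
    ultimately have "\<forall>\<^sub>F j in sequentially. \<bar>g (r (n j)) k (i j) - F \<gamma> k t\<bar> \<le> e"
    proof eventually_elim
      case (elim j)
      then show ?case using \<rho>(3)[of j] \<sigma>(3)[of j] small[of M j] M by linarith
    qed
    then obtain j where "\<bar>g (r (n j)) k (i j) - F \<gamma> k t\<bar> \<le> e"
      by (auto simp: eventually_sequentially)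
    with ni(4) show False by blast
  qed
  have "(\<gamma> k has_real_derivative F \<gamma> k t) (at t)" if k: "k < m" for k t
    unfolding has_field_derivative_def has_derivative_at_alt
  proof (intro conjI allI impI)
    fix e :: real assume e: "e > 0"
    obtain \<eta> n0 where \<eta>: "\<eta> > 0" and g: "\<And>n i. n \<ge> n0 \<Longrightarrow> i < 2 * (?S (r n))\<^sup>2 \<Longrightarrow>
        \<bar>grid (?S (r n)) i - t\<bar> \<le> \<eta> \<Longrightarrow> \<bar>g (r n) k i - F \<gamma> k t\<bar> \<le> e"
      using key[OF k e, of t] by metis
    \<comment> \<open>Half of \<open>\<eta>\<close> is spent on \<open>y\<close> and half on the
      cell width, so every cell that meets the interval between \<open>t\<close> and
      \<open>y\<close> starts within \<open>\<eta>\<close> of \<open>t\<close>.\<close>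
    have "\<bar>\<gamma> k y - \<gamma> k t - F \<gamma> k t * (y - t)\<bar> \<le> e * \<bar>y - t\<bar>" if y: "\<bar>y - t\<bar> < \<eta> / 2" for y
    proof -
      obtain n1 where n1: "real n1 > 2 / \<eta>" "real n1 > \<bar>y\<bar>" "real n1 > \<bar>t\<bar>"
        using reals_Archimedean2[of "2 / \<eta> + \<bar>y\<bar> + \<bar>t\<bar>"] \<eta>
        by (smt (verit) divide_nonneg_pos)
      have "\<bar>\<Gamma> (r n) k y - \<Gamma> (r n) k t - F \<gamma> k t * (y - t)\<bar> \<le> e * \<bar>y - t\<bar>"
        if n: "n \<ge> max n0 n1" for n
      proof -
        let ?n = "Suc (r n)"
        have big: "real ?n > 2 / \<eta>" "\<bar>y\<bar> \<le> real ?n" "\<bar>t\<bar> \<le> real ?n"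
          using n n1 rge[of n] by linarith+
        have "1 / real ?n < \<eta> / 2" using big(1) \<eta> by (simp add: field_simps)
        have near: "\<bar>g (r n) k i - F \<gamma> k t\<bar> \<le> e"
          if "i < 2 * ?n\<^sup>2" "grid ?n i < max y t" "min y t < grid ?n i + 1 / ?n" for i
        proof (rule g)
          show "\<bar>grid ?n i - t\<bar> \<le> \<eta>"
            using that(2,3) y \<open>1 / real ?n < \<eta> / 2\<close> by linarith
        qed (use n that(1) in auto)
        show ?thesis
        proof (cases "t \<le> y")
          case True
          then show ?thesis
            using polyline_increment[of ?n t y "g (r n) k" "F \<gamma> k t" e "c k"] big near
            by (simp add: \<Gamma>_def max_def min_def)
        next
          case False
          then have "\<bar>polyline ?n (c k) (g (r n) k) t - polyline ?n (c k) (g (r n) k) y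
              - F \<gamma> k t * (t - y)\<bar> \<le> e * (t - y)"
            using polyline_increment[of ?n y t "g (r n) k" "F \<gamma> k t" e "c k"] big near
            by (simp add: max_def min_def)
          moreover have "F \<gamma> k t * (y - t) = - (F \<gamma> k t * (t - y))" by (simp add: algebra_simps)
          ultimately show ?thesis using False unfolding \<Gamma>_def by (smt (verit))
        qed
      qed
      then have ev: "\<forall>\<^sub>F n in sequentially.
          \<bar>\<Gamma> (r n) k y - \<Gamma> (r n) k t - F \<gamma> k t * (y - t)\<bar> \<le> e * \<bar>y - t\<bar>"
        unfolding eventually_sequentially by blast
      have "(\<lambda>n. \<bar>\<Gamma> (r n) k y - \<Gamma> (r n) k t - F \<gamma> k t * (y - t)\<bar>) \<longlonglongrightarrow>
          \<bar>\<gamma> k y - \<gamma> k t - F \<gamma> k t * (y - t)\<bar>"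
        by (intro tendsto_intros lim k)
      then show ?thesis by (rule tendsto_upperbound[OF _ ev]) simp
    qed
    then show "\<exists>d>0. \<forall>y. norm (y - t) < d \<longrightarrow>
        norm (\<gamma> k y - \<gamma> k t - F \<gamma> k t * (y - t)) \<le> e * norm (y - t)"
      using \<eta> by (intro exI[of _ "\<eta> / 2"]) auto
  qed (rule bounded_linear_mult_right)
  with \<gamma> show ?thesis by (rule that)
qed

subsection \<open>A priori bounds\<close>

text \<open>The inverse of the map taking \<open>v\<close> to the momentum per unit mass
  \<open>v / sqrt (1 - v^2)\<close>; in terms of the rapidity it is \<open>tanh\<close>.\<close>

definition vel :: "real \<Rightarrow> real" where
  "vel p = p / sqrt (1 + p\<^sup>2)"

text \<open>In terms of the rapidity \<open>\<theta>\<close> (\<open>p = sinh \<theta>\<close>) this is \<open>exp (- \<theta>)\<close>.\<close>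

definition redshift :: "real \<Rightarrow> real" where
  "redshift p = sqrt (1 + p\<^sup>2) - p"

lemma one_plus_square_pos: "1 + p\<^sup>2 > (0 :: real)"
  by (simp add: add_pos_nonneg)

lemma sqrt_one_plus_square_gt: "\<bar>p\<bar> < sqrt (1 + p\<^sup>2)"
  by (rule real_less_rsqrt) simp

lemma abs_vel_less: "\<bar>vel p\<bar> < 1"
proof -
  have "sqrt (1 + p\<^sup>2) > 0" using one_plus_square_pos by simp
  then show ?thesis using sqrt_one_plus_square_gt[of p] by (simp add: vel_def abs_divide)
qed

lemma vel_less: "vel p < 1" and vel_greater: "- 1 < vel p"
  using abs_vel_less[of p] by auto

lemma vel_minus: "vel (- p) = - vel p"
  by (simp add: vel_def)

lemma redshift_pos: "redshift p > 0"
  using sqrt_one_plus_square_gt[of p] by (simp add: redshift_def)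

lemma has_real_derivative_redshift: "(redshift has_real_derivative (vel p - 1)) (at p)"
  unfolding redshift_def[abs_def] vel_def using one_plus_square_pos[of p]
  by (auto intro!: derivative_eq_intros simp: field_simps)

lemma redshift_antimono: "p \<le> q \<Longrightarrow> redshift q \<le> redshift p"
proof (rule DERIV_nonpos_imp_nonincreasing[of p q redshift])
  fix x
  show "\<exists>y. (redshift has_real_derivative y) (at x) \<and> y \<le> 0"
    using has_real_derivative_redshift[of x] vel_less[of x] by (intro exI[of _ "vel x - 1"]) auto
qed

lemma has_real_derivative_vel: "(vel has_real_derivative 1 / (1 + p\<^sup>2) / sqrt (1 + p\<^sup>2)) (at p)"
proof -
  have s: "sqrt (1 + p\<^sup>2) > 0" "sqrt (1 + p\<^sup>2) * sqrt (1 + p\<^sup>2) = 1 + p\<^sup>2" using one_plus_square_pos[of p] by auto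
  have "(vel has_real_derivative (sqrt (1 + p\<^sup>2) - p * (p / sqrt (1 + p\<^sup>2))) / (sqrt (1 + p\<^sup>2) * sqrt (1 + p\<^sup>2))) (at p)"
    unfolding vel_def[abs_def] using one_plus_square_pos[of p]
    by (auto intro!: derivative_eq_intros simp: field_simps)
  moreover have "sqrt (1 + p\<^sup>2) - p * (p / sqrt (1 + p\<^sup>2)) = 1 / sqrt (1 + p\<^sup>2)"
    using s by (simp add: field_simps power2_eq_square)
  ultimately show ?thesis using s by (simp add: field_simps)
qed

lemma vel_strict_mono: "p < q \<Longrightarrow> vel p < vel q"
proof (rule DERIV_pos_imp_increasing[of p q vel])
  fix x
  show "\<exists>y. (vel has_real_derivative y) (at x) \<and> 0 < y"
    using has_real_derivative_vel[of x] one_plus_square_pos[of x]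
    by (intro exI[of _ "1 / (1 + x\<^sup>2) / sqrt (1 + x\<^sup>2)"]) auto
qed

lemma vel_mono: "p \<le> q \<Longrightarrow> vel p \<le> vel q"
  using vel_strict_mono[of p q] by (cases "p = q") auto

lemma continuous_on_vel [continuous_intros]:
  assumes "continuous_on A f" shows "continuous_on A (\<lambda>x. vel (f x))"
proof -
  have "continuous_on UNIV vel"
    by (rule DERIV_continuous_on) (use has_real_derivative_vel in blast)
  from continuous_on_compose2[OF this assms] show ?thesis by auto
qed

lemma tendsto_vel [tendsto_intros]: "(f \<longlongrightarrow> x) F \<Longrightarrow> ((\<lambda>n. vel (f n)) \<longlongrightarrow> vel x) F"
  using isCont_tendsto_compose[OF DERIV_isCont[OF has_real_derivative_vel]] .

lemma momentum_vel: "vel p / sqrt (1 - (vel p)\<^sup>2) = p"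
proof -
  have s: "sqrt (1 + p\<^sup>2) > 0" "(sqrt (1 + p\<^sup>2))\<^sup>2 = 1 + p\<^sup>2" using one_plus_square_pos[of p] by auto
  have "1 - (vel p)\<^sup>2 = 1 / (1 + p\<^sup>2)"
    using one_plus_square_pos[of p] by (simp add: vel_def power_divide s(2) field_simps)
  then show ?thesis using s(1) by (simp add: vel_def real_sqrt_divide)
qed

lemma vel_momentum:
  assumes "\<bar>v\<bar> < 1"
  shows "vel (v / sqrt (1 - v\<^sup>2)) = v"
proof -
  have v: "1 - v\<^sup>2 > 0" using assms by (simp add: abs_square_less_1)
  have "1 + (v / sqrt (1 - v\<^sup>2))\<^sup>2 = 1 / (1 - v\<^sup>2)"
    using v by (simp add: power_divide field_simps)
  then show ?thesis using v by (simp add: vel_def real_sqrt_divide)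
qed

section \<open>The potential with a cutoff and the estimates\<close>

text \<open>The potential \<open>1 / x\<close>, continued below \<open>\<delta>\<close> by its
  tangent line at \<open>\<delta>\<close>. Its derivative then carries the same cutoff as the force.
  The case distinction is a set membership to fit the gluing rule for derivatives.\<close>

definition cutoff_pot :: "real \<Rightarrow> real \<Rightarrow> real" where
  "cutoff_pot \<delta> x = (if x \<in> {\<delta>..} then 1 / x else 2 / \<delta> - x / \<delta>\<^sup>2)"

lemma has_real_derivative_cutoff_pot:
  assumes "\<delta> > 0"
  shows "(cutoff_pot \<delta> has_real_derivative - 1 / (max \<delta> x)\<^sup>2) (at x)"
proof -
  have "((\<lambda>x. if x \<in> {\<delta>..} then 1 / x else 2 / \<delta> - x / \<delta>\<^sup>2) has_vector_derivative
      (if x \<in> {\<delta>..} then - 1 / (max \<delta> x)\<^sup>2 else - 1 / \<delta>\<^sup>2)) (at x within {\<delta>..} \<union> {..<\<delta>})"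
  proof (rule has_vector_derivative_If_within_closures)
    assume "x \<in> {\<delta>..} \<union> closure {\<delta>..} \<inter> closure {..<\<delta>}"
    then have x: "x \<ge> \<delta>" by auto
    then have "((\<lambda>x. 1 / x) has_real_derivative - 1 / (max \<delta> x)\<^sup>2) (at x)"
      using assms by (auto intro!: derivative_eq_intros simp: power2_eq_square)
    then show "((\<lambda>x. 1 / x) has_vector_derivative - 1 / (max \<delta> x)\<^sup>2)
        (at x within {\<delta>..} \<union> closure {\<delta>..} \<inter> closure {..<\<delta>})"
      unfolding has_real_derivative_iff_has_vector_derivative by (rule has_vector_derivative_at_within)
  next
    have "((\<lambda>x. 2 / \<delta> - x / \<delta>\<^sup>2) has_real_derivative - 1 / \<delta>\<^sup>2) (at x)"
      using assms by (auto intro!: derivative_eq_intros simp: power2_eq_square)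
    then show "((\<lambda>x. 2 / \<delta> - x / \<delta>\<^sup>2) has_vector_derivative - 1 / \<delta>\<^sup>2)
        (at x within {..<\<delta>} \<union> closure {\<delta>..} \<inter> closure {..<\<delta>})"
      unfolding has_real_derivative_iff_has_vector_derivative by (rule has_vector_derivative_at_within)
  qed (use assms in \<open>auto simp: power2_eq_square field_simps\<close>)
  moreover have "{\<delta>..} \<union> {..<\<delta>} = UNIV" by auto
  moreover have "(if x \<in> {\<delta>..} then - 1 / (max \<delta> x)\<^sup>2 else - 1 / \<delta>\<^sup>2) = - 1 / (max \<delta> x)\<^sup>2"
    by (auto simp: max_def)
  ultimately show ?thesis
    unfolding has_real_derivative_iff_has_vector_derivative cutoff_pot_def[abs_def] by simp
qed

lemma cutoff_pot_eq: "\<delta> \<le> x \<Longrightarrow> cutoff_pot \<delta> x = 1 / x"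
  by (simp add: cutoff_pot_def)

lemma cutoff_pot_antimono:
  assumes "\<delta> > 0" "x \<le> y"
  shows "cutoff_pot \<delta> y \<le> cutoff_pot \<delta> x"
proof (rule DERIV_nonpos_imp_nonincreasing[OF assms(2)])
  fix x
  show "\<exists>y. (cutoff_pot \<delta> has_real_derivative y) (at x) \<and> y \<le> 0"
    using has_real_derivative_cutoff_pot[OF assms(1), of x]
    by (intro exI[of _ "- 1 / (max \<delta> x)\<^sup>2"]) auto
qed

text \<open>One particle is treated at a time: \<open>\<omega>\<close> stands for the velocity of
  the other one, in the mirrored coordinate, at the emission time \<open>s t\<close>. Its bound up
  to time 0 by the initial velocity will come from monotonicity of the momentum. The admissible
  \<open>\<delta>\<close> depends on the coupling and the initial data, the admissible
  \<open>P\<close> in addition on \<open>\<delta>\<close>.\<close>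

lemma a_priori_bounds:
  fixes \<alpha> \<omega> s :: "real \<Rightarrow> real" and \<alpha>\<^sub>0 \<beta>\<^sub>0 \<kappa> \<delta> P r\<^sub>0 :: real
  defines "c \<equiv> (1 + vel \<beta>\<^sub>0) / (\<kappa> * (1 - vel \<beta>\<^sub>0) * (1 - vel \<alpha>\<^sub>0))"
    and "\<alpha>\<^sub>1 \<equiv> min \<alpha>\<^sub>0 (- \<beta>\<^sub>0 - 1)"
    and "C \<equiv> 2 * \<kappa> * (1 - vel (min \<alpha>\<^sub>0 (- \<beta>\<^sub>0 - 1))) / (- vel \<beta>\<^sub>0 - vel (min \<alpha>\<^sub>0 (- \<beta>\<^sub>0 - 1)))"
  assumes \<kappa>: "\<kappa> > 0" and \<delta>: "\<delta> > 0" and r0: "r\<^sub>0 > 0" "r\<^sub>0 \<le> - s 0"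
    and d\<alpha>: "\<And>t. (\<alpha> has_real_derivative \<kappa> * sigma (\<omega> t) / (max \<delta> (t - s t))\<^sup>2) (at t)"
    and ds: "\<And>t. (s has_real_derivative (1 - vel (max (- P) (\<alpha> t))) / (1 + \<omega> t)) (at t)"
    and \<omega>: "\<And>t. \<bar>\<omega> t\<bar> < 1" "\<And>t. t \<le> 0 \<Longrightarrow> \<omega> t \<le> vel \<beta>\<^sub>0"
    and \<alpha>0: "\<alpha> 0 = \<alpha>\<^sub>0"
    and \<delta>small: "1 / r\<^sub>0 + c * redshift (- \<beta>\<^sub>0) + redshift \<alpha>\<^sub>0 / (\<kappa> * (1 + vel \<alpha>\<^sub>0)) < 1 / \<delta>"
    and Plarge: "- P < \<alpha>\<^sub>1" "redshift \<alpha>\<^sub>1 + C / \<delta> < P"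
  shows "\<delta> < t - s t" and "- P < \<alpha> t"
proof -
  note vel_minus [simp]
  define R where "R = (\<lambda>t. t - s t)"
  define s' where "s' = (\<lambda>t. (1 - vel (max (- P) (\<alpha> t))) / (1 + \<omega> t))"
  define f where "f = (\<lambda>t. \<kappa> * sigma (\<omega> t) / (max \<delta> (R t))\<^sup>2)"
  define K where "K = (\<lambda>t. 1 / (max \<delta> (R t))\<^sup>2)"
  define \<Psi> where "\<Psi> = (\<lambda>t. cutoff_pot \<delta> (R t))"
  define H where "H = (\<lambda>t. redshift (\<alpha> t))"
  have \<omega>': "1 + \<omega> t > 0" "1 - \<omega> t > 0" for t using \<omega>(1)[of t] by auto
  have K: "K t > 0" for t using \<delta> by (simp add: K_def max_def)
  have f: "f t = \<kappa> * (1 - \<omega> t) / (1 + \<omega> t) * K t" for t by (simp add: f_def K_def sigma_def)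
  have f0: "f t > 0" for t unfolding f using \<kappa> \<omega>'[of t] K[of t] by simp
  have s'0: "s' t > 0" for t using vel_less[of "max (- P) (\<alpha> t)"] \<omega>'[of t] by (simp add: s'_def)
  have dR: "(R has_real_derivative 1 - s' t) (at t)" for t
    unfolding R_def s'_def by (intro derivative_intros ds)
  have d\<Psi>: "(\<Psi> has_real_derivative (s' t - 1) * K t) (at t)" for t
    using DERIV_chain2[OF has_real_derivative_cutoff_pot[OF \<delta>] dR, of t]
    by (simp add: \<Psi>_def K_def algebra_simps diff_divide_distrib)
  have dH: "(H has_real_derivative - ((1 - vel (\<alpha> t)) * f t)) (at t)" for t
    using DERIV_chain2[OF has_real_derivative_redshift d\<alpha>, of t]
    by (simp add: H_def f_def R_def algebra_simps diff_divide_distrib)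
  \<comment> \<open>Both \<open>sigma (\<omega> t)\<close> and \<open>s' t\<close> contain the
    factor \<open>1 / (1 + \<omega> t)\<close>. Trading one for the other expresses the decrease of
    \<open>H\<close> through \<open>s'\<close>, which also governs the change of
    \<open>\<Psi>\<close>.\<close>
  have force: "(1 - vel (max (- P) (\<alpha> t))) * f t = \<kappa> * (1 - \<omega> t) * s' t * K t" for t
    using \<omega>'[of t] by (simp add: f s'_def)
  \<comment> \<open>Below the cutoff the true momentum is smaller than the one that drives the
    motion. The identity then weakens to an inequality, in the direction that the first two
    estimates need.\<close>
  have force_le: "\<kappa> * (1 - \<omega> t) * s' t * K t \<le> (1 - vel (\<alpha> t)) * f t" for t
    unfolding force[symmetric] using vel_mono[of "\<alpha> t" "max (- P) (\<alpha> t)"] f0[of t]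
    by (intro mult_right_mono) auto
  have mono: "\<alpha> x \<le> \<alpha> y" if "x \<le> y" for x y
    using d\<alpha> f0 that unfolding f_def R_def
    by (intro DERIV_nonneg_imp_nondecreasing[of x y \<alpha>]) (auto intro: less_imp_le)
  have cont\<alpha>: "continuous_on A \<alpha>" for A
    by (rule DERIV_continuous_on) (use d\<alpha> in \<open>blast intro: has_field_derivative_at_within\<close>)
  have level: "\<exists>x. t \<le> x \<and> x \<le> 0 \<and> \<alpha> x = a" if "t \<le> 0" "\<alpha> t \<le> a" "a \<le> \<alpha>\<^sub>0" for t a
    using IVT'[of \<alpha> t a 0] that \<alpha>0 cont\<alpha> by auto
  have P: "- P < \<alpha>\<^sub>0" "- P < - \<beta>\<^sub>0" "\<alpha>\<^sub>1 \<le> \<alpha>\<^sub>0" "\<alpha>\<^sub>1 < - \<beta>\<^sub>0" using Plarge by (auto simp: \<alpha>\<^sub>1_def)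
  have v: "1 + vel \<beta>\<^sub>0 > 0" "1 - vel \<beta>\<^sub>0 > 0" "1 - vel \<alpha>\<^sub>0 > 0" "1 + vel \<alpha>\<^sub>0 > 0"
    using vel_less vel_greater[of \<beta>\<^sub>0] vel_greater[of \<alpha>\<^sub>0] by (auto simp: add_pos_pos)
  have c: "c > 0" unfolding c_def using v \<kappa> by (intro divide_pos_pos mult_pos_pos)
  have e: "redshift \<alpha>\<^sub>0 / (\<kappa> * (1 + vel \<alpha>\<^sub>0)) > 0" using v \<kappa> redshift_pos by (intro divide_pos_pos mult_pos_pos)
  have cr: "c * redshift (- \<beta>\<^sub>0) > 0" using c redshift_pos by simp
  have "1 / r\<^sub>0 < 1 / \<delta>" using \<delta>small e cr by linarith
  then have "\<delta> \<le> r\<^sub>0" using \<delta> r0(1) by (simp add: field_simps)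
  then have \<Psi>0: "\<Psi> 0 \<le> 1 / r\<^sub>0"
    using cutoff_pot_antimono[OF \<delta>, of r\<^sub>0 "R 0"] r0 by (simp add: \<Psi>_def cutoff_pot_eq R_def)
  text \<open>For \<open>t \<le> 0\<close> the speed bounds keep \<open>s'\<close> away from 0, so \<open>c\<close> can be chosen such that
    \<open>1 / R - c H\<close> is nondecreasing.\<close>
  have bwd: "\<Psi> t \<le> 1 / r\<^sub>0 + c * H t" if "t \<le> 0" for t
  proof -
    have "\<Psi> t - c * H t \<le> \<Psi> 0 - c * H 0"
    proof (rule DERIV_nonneg_imp_nondecreasing[OF that])
      fix x :: real assume x: "x \<le> 0"
      have "vel (max (- P) (\<alpha> x)) \<le> vel \<alpha>\<^sub>0"
        using mono[OF x] \<alpha>0 P by (intro vel_mono) auto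
      then have q: "(1 - vel \<alpha>\<^sub>0) / (1 + vel \<beta>\<^sub>0) \<le> s' x"
        unfolding s'_def using \<omega>'[of x] \<omega>(2)[OF x] v by (intro frac_le) auto
      have "1 = c * \<kappa> * (1 - vel \<beta>\<^sub>0) * ((1 - vel \<alpha>\<^sub>0) / (1 + vel \<beta>\<^sub>0))"
        using v \<kappa> by (simp add: c_def)
      also have "\<dots> \<le> c * \<kappa> * (1 - \<omega> x) * s' x"
        using \<omega>(2)[OF x] v c \<kappa> q s'0[of x] by (intro mult_mono) auto
      finally have 1: "1 \<le> c * \<kappa> * (1 - \<omega> x) * s' x" .
      have "0 \<le> (s' x - 1 + c * \<kappa> * (1 - \<omega> x) * s' x) * K x"
        using 1 s'0[of x] K[of x] by (intro mult_nonneg_nonneg) auto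
      also have "\<dots> = (s' x - 1) * K x + c * (\<kappa> * (1 - \<omega> x) * s' x * K x)" by (simp add: algebra_simps)
      also have "\<dots> \<le> (s' x - 1) * K x + c * ((1 - vel (\<alpha> x)) * f x)"
        using force_le[of x] c by (intro add_left_mono mult_left_mono) auto
      finally have "0 \<le> (s' x - 1) * K x - c * - ((1 - vel (\<alpha> x)) * f x)" by simp
      moreover have "((\<lambda>t. \<Psi> t - c * H t) has_real_derivative
          (s' x - 1) * K x - c * - ((1 - vel (\<alpha> x)) * f x)) (at x)"
        by (intro derivative_intros d\<Psi> DERIV_cmult dH)
      ultimately show "\<exists>y. ((\<lambda>t. \<Psi> t - c * H t) has_real_derivative y) (at x) \<and> 0 \<le> y" by blast
    qed
    moreover have "c * H 0 \<ge> 0" using c redshift_pos[of "\<alpha> 0"] by (simp add: H_def)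
    ultimately show ?thesis using \<Psi>0 by linarith
  qed
  have far: "\<delta> < R t" if "\<Psi> t < 1 / \<delta>" for t
  proof (rule ccontr)
    assume "\<not> \<delta> < R t"
    then show False using cutoff_pot_antimono[OF \<delta>, of "R t" \<delta>] that by (simp add: \<Psi>_def cutoff_pot_eq)
  qed
  text \<open>Once \<open>A' \<le> - vel \<beta>\<^sub>0\<close>, the particles approach each other towards the future, so \<open>R\<close> only
    grows towards the past; before that, \<open>H\<close> is bounded.\<close>
  have past: "\<Psi> t < 1 / \<delta>" if t: "t \<le> 0" for t
  proof (cases "- \<beta>\<^sub>0 \<le> \<alpha> t")
    case True
    then have "c * H t \<le> c * redshift (- \<beta>\<^sub>0)" unfolding H_def using c redshift_antimono by simp
    then show ?thesis using bwd[OF t] \<delta>small e by linarith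
  next
    case False
    \<comment> \<open>A comparison time with controlled potential: time 0 if
      \<open>\<alpha>\<^sub>0 \<le> - \<beta>\<^sub>0\<close>, otherwise a crossing of the level
      \<open>- \<beta>\<^sub>0\<close>, where the backward estimate applies with
      \<open>H x = redshift (- \<beta>\<^sub>0)\<close>.\<close>
    have "\<exists>x. t \<le> x \<and> x \<le> 0 \<and> \<alpha> x \<le> - \<beta>\<^sub>0 \<and> \<Psi> x \<le> 1 / r\<^sub>0 + c * redshift (- \<beta>\<^sub>0)"
    proof (cases "\<alpha>\<^sub>0 \<le> - \<beta>\<^sub>0")
      case True
      then show ?thesis using \<Psi>0 t cr \<alpha>0 by (intro exI[of _ 0]) auto
    next
      case False
      then obtain x where "t \<le> x" "x \<le> 0" "\<alpha> x = - \<beta>\<^sub>0"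
        using level[OF t, of "- \<beta>\<^sub>0"] \<open>\<not> - \<beta>\<^sub>0 \<le> \<alpha> t\<close> by auto
      then show ?thesis using bwd[of x] by (intro exI[of _ x]) (auto simp: H_def)
    qed
    then obtain x where x: "t \<le> x" "x \<le> 0" "\<alpha> x \<le> - \<beta>\<^sub>0" "\<Psi> x \<le> 1 / r\<^sub>0 + c * redshift (- \<beta>\<^sub>0)" by blast
    have "R x \<le> R t"
    proof (rule DERIV_nonpos_imp_nonincreasing[OF x(1)])
      fix y assume y: "t \<le> y" "y \<le> x"
      have "vel (max (- P) (\<alpha> y)) \<le> vel (- \<beta>\<^sub>0)"
        using mono[OF y(2)] x(3) P by (intro vel_mono) auto
      then have "1 + \<omega> y \<le> 1 - vel (max (- P) (\<alpha> y))" using \<omega>(2)[of y] x(2) y(2) by auto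
      then have "1 - s' y \<le> 0" unfolding s'_def using \<omega>'[of y] by (simp add: le_divide_eq)
      then show "\<exists>d. (R has_real_derivative d) (at y) \<and> d \<le> 0" using dR by blast
    qed
    then have "\<Psi> t \<le> \<Psi> x" unfolding \<Psi>_def by (rule cutoff_pot_antimono[OF \<delta>])
    then show ?thesis using x(4) \<delta>small e by linarith
  qed
  text \<open>For \<open>t \<ge> 0\<close> the distance shrinks only while \<open>B' (s) < - A' \<le> - vel \<alpha>\<^sub>0\<close>, and then the
    factor \<open>1 - B' (s)\<close> of the force is bounded below.\<close>
  have future: "\<Psi> t < 1 / \<delta>" if t: "0 \<le> t" for t
  proof -
    let ?m = "\<kappa> * (1 + vel \<alpha>\<^sub>0)"
    have m: "?m > 0" using v \<kappa> by simp
    have "\<Psi> t + H t / ?m \<le> \<Psi> 0 + H 0 / ?m"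
    proof (rule DERIV_nonpos_imp_nonincreasing[OF t])
      fix x :: real assume x: "0 \<le> x"
      have vx: "vel \<alpha>\<^sub>0 \<le> vel (max (- P) (\<alpha> x))"
        using mono[OF x] \<alpha>0 P by (intro vel_mono) auto
      have "s' x - 1 \<le> s' x * (1 - \<omega> x) / (1 + vel \<alpha>\<^sub>0)"
      proof (cases "s' x \<le> 1")
        case True
        then have "s' x - 1 \<le> 0" by simp
        also have "0 \<le> s' x * (1 - \<omega> x) / (1 + vel \<alpha>\<^sub>0)"
          using s'0[of x] \<omega>'[of x] v by (intro divide_nonneg_pos mult_nonneg_nonneg) auto
        finally show ?thesis .
      next
        case False
        then have "1 + \<omega> x < 1 - vel (max (- P) (\<alpha> x))"
          using \<omega>'[of x] by (simp add: s'_def not_le less_divide_eq)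
        then have "1 + vel \<alpha>\<^sub>0 \<le> 1 - \<omega> x" using vx by simp
        then have "1 \<le> (1 - \<omega> x) / (1 + vel \<alpha>\<^sub>0)" using v by simp
        then have "s' x * 1 \<le> s' x * ((1 - \<omega> x) / (1 + vel \<alpha>\<^sub>0))"
          using s'0[of x] by (intro mult_left_mono) auto
        then show ?thesis by simp
      qed
      then have "(s' x - 1) * K x \<le> s' x * (1 - \<omega> x) / (1 + vel \<alpha>\<^sub>0) * K x"
        using K[of x] by (intro mult_right_mono) auto
      also have "\<dots> = (\<kappa> * (1 - \<omega> x) * s' x * K x) / ?m" using \<kappa> by simp
      also have "\<dots> \<le> ((1 - vel (\<alpha> x)) * f x) / ?m"
        using m force_le[of x] by (intro divide_right_mono) auto
      finally have "(s' x - 1) * K x + - ((1 - vel (\<alpha> x)) * f x) / ?m \<le> 0" by simp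
      moreover have "((\<lambda>t. \<Psi> t + H t / ?m) has_real_derivative
          (s' x - 1) * K x + - ((1 - vel (\<alpha> x)) * f x) / ?m) (at x)"
        by (intro derivative_intros d\<Psi> DERIV_cdivide dH)
      ultimately show "\<exists>y. ((\<lambda>t. \<Psi> t + H t / ?m) has_real_derivative y) (at x) \<and> y \<le> 0" by blast
    qed
    moreover have "H t / ?m > 0" using m redshift_pos[of "\<alpha> t"] by (simp add: H_def)
    ultimately have "\<Psi> t \<le> \<Psi> 0 + H 0 / ?m" by linarith
    then show ?thesis using \<Psi>0 \<delta>small cr \<alpha>0 by (simp add: H_def)
  qed
  have sep: "\<delta> < R t" for t using far past future by (cases "t \<le> 0") auto
  then show "\<delta> < t - s t" unfolding R_def .
  show "- P < \<alpha> t"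
  proof (rule ccontr)
    assume "\<not> - P < \<alpha> t"
    then have t: "\<alpha> t \<le> - P" by simp
    then have "t \<le> 0" using mono[of 0 t] \<alpha>0 P by (cases "t \<le> 0") auto
    \<comment> \<open>The momentum would rise from \<open>- P\<close> at \<open>y\<close> to
      \<open>\<alpha>\<^sub>1\<close> at \<open>x\<close>. But \<open>H y = redshift (- P)\<close>
      is at least \<open>P\<close>, whereas the estimate from \<open>x\<close> bounds it by
      \<open>redshift \<alpha>\<^sub>1 + C / \<delta>\<close>.\<close>
    then obtain y where y: "y \<le> 0" "\<alpha> y = - P" using level[of t "- P"] t P by auto
    then obtain x where x: "y \<le> x" "x \<le> 0" "\<alpha> x = \<alpha>\<^sub>1" using level[of y \<alpha>\<^sub>1] P Plarge by auto
    \<comment> \<open>\<open>?q\<close> bounds \<open>s'\<close> from below while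
      \<open>\<alpha> \<le> \<alpha>\<^sub>1\<close> and time is at most 0. It exceeds 1 because the
      term \<open>- 1\<close> in \<open>\<alpha>\<^sub>1\<close> keeps it strictly below
      \<open>- \<beta>\<^sub>0\<close>. \<open>C\<close> is chosen such that
      \<open>C * (s' - 1) = 2 * \<kappa> * s'\<close> at \<open>s' = ?q\<close>.\<close>
    let ?q = "(1 - vel \<alpha>\<^sub>1) / (1 + vel \<beta>\<^sub>0)"
    have gap: "- vel \<beta>\<^sub>0 - vel \<alpha>\<^sub>1 > 0" using vel_strict_mono[OF P(4)] by simp
    have C: "C > 0" "C * (?q - 1) = 2 * \<kappa> * ?q"
    proof -
      have C': "C = 2 * \<kappa> * (1 - vel \<alpha>\<^sub>1) / (- vel \<beta>\<^sub>0 - vel \<alpha>\<^sub>1)" unfolding C_def \<alpha>\<^sub>1_def ..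
      show "C > 0" unfolding C' using gap \<kappa> vel_less[of \<alpha>\<^sub>1] by (intro divide_pos_pos mult_pos_pos) auto
      have "?q - 1 = (- vel \<beta>\<^sub>0 - vel \<alpha>\<^sub>1) / (1 + vel \<beta>\<^sub>0)" using v by (simp add: field_simps)
      then show "C * (?q - 1) = 2 * \<kappa> * ?q" unfolding C' using gap by simp
    qed
    text \<open>While \<open>\<alpha> \<le> \<alpha>\<^sub>1\<close>, \<open>s'\<close> exceeds 1 by a fixed amount, so \<open>s'\<close> is at most a multiple
      of \<open>s' - 1\<close> and \<open>H + C / R\<close> is nondecreasing.\<close>
    have "H y + C * \<Psi> y \<le> H x + C * \<Psi> x"
    proof (rule DERIV_nonneg_imp_nondecreasing[OF x(1)])
      fix z assume z: "y \<le> z" "z \<le> x"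
      have az: "- P \<le> \<alpha> z" "\<alpha> z \<le> \<alpha>\<^sub>1" using mono[OF z(1)] mono[OF z(2)] x y by auto
      then have "vel (max (- P) (\<alpha> z)) \<le> vel \<alpha>\<^sub>1" using Plarge by (intro vel_mono) auto
      then have q: "?q \<le> s' z"
        unfolding s'_def using \<omega>'[of z] \<omega>(2)[of z] z x v vel_less[of \<alpha>\<^sub>1] by (intro frac_le) auto
      have "?q > 1" using gap v by (simp add: less_divide_eq)
      \<comment> \<open>The difference \<open>C * (s' - 1) - 2 * \<kappa> * s'\<close> vanishes at
        \<open>?q\<close> and has slope \<open>C - 2 * \<kappa>\<close>; positivity of the slope
        extends the inequality to all larger \<open>s'\<close>.\<close>
      have "C > 2 * \<kappa>"
      proof (rule ccontr)
        assume "\<not> C > 2 * \<kappa>"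
        then have "C * (?q - 1) \<le> 2 * \<kappa> * (?q - 1)" using \<open>?q > 1\<close> by (intro mult_right_mono) auto
        then have "2 * \<kappa> * ?q \<le> 2 * \<kappa> * (?q - 1)" using C(2) by simp
        then show False using \<kappa> by (simp add: right_diff_distrib)
      qed
      then have "(C - 2 * \<kappa>) * ?q \<le> (C - 2 * \<kappa>) * s' z" using q by (intro mult_left_mono) auto
      moreover have "(C - 2 * \<kappa>) * ?q = C"
        using C(2) unfolding left_diff_distrib right_diff_distrib by linarith
      ultimately have "2 * \<kappa> * s' z \<le> C * (s' z - 1)" by (simp add: algebra_simps)
      moreover have "\<kappa> * (1 - \<omega> z) * s' z \<le> \<kappa> * 2 * s' z"
        using \<omega>(1)[of z] \<kappa> s'0[of z] by (intro mult_right_mono mult_left_mono) auto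
      ultimately have "\<kappa> * (1 - \<omega> z) * s' z * K z \<le> C * (s' z - 1) * K z"
        using K[of z] by (intro mult_right_mono) auto
      moreover have "(1 - vel (\<alpha> z)) * f z = \<kappa> * (1 - \<omega> z) * s' z * K z"
        using force[of z] az by simp
      ultimately have "0 \<le> - ((1 - vel (\<alpha> z)) * f z) + C * ((s' z - 1) * K z)" by (simp add: mult.assoc)
      moreover have "((\<lambda>t. H t + C * \<Psi> t) has_real_derivative
          - ((1 - vel (\<alpha> z)) * f z) + C * ((s' z - 1) * K z)) (at z)"
        by (intro derivative_intros d\<Psi> DERIV_cmult dH)
      ultimately show "\<exists>d. ((\<lambda>t. H t + C * \<Psi> t) has_real_derivative d) (at z) \<and> 0 \<le> d" by blast
    qed
    moreover have "C * \<Psi> y > 0"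
      using C(1) sep[of y] \<delta> by (simp add: \<Psi>_def cutoff_pot_eq)
    moreover have "C * \<Psi> x \<le> C / \<delta>"
      using mult_left_mono[OF less_imp_le[OF past[OF x(2)]], of C] C(1) by simp
    moreover have "H x = redshift \<alpha>\<^sub>1" using x by (simp add: H_def)
    moreover have "P \<le> H y" using y by (simp add: H_def redshift_def add_nonneg_nonneg)
    ultimately show False using Plarge(2) by linarith
  qed
qed

subsection \<open>The equations with cutoffs\<close>

text \<open>For either sign of \<open>t\<close> one of the two intervals is empty or a single point,
  so its integral is 0.\<close>

definition prim :: "(real \<Rightarrow> real) \<Rightarrow> real \<Rightarrow> real" where
  "prim u t = integral {0..t} u - integral {t..0} u"

lemma prim_0 [simp]: "prim u 0 = 0"
  by (simp add: prim_def)

lemma has_real_derivative_prim: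
  assumes "continuous_on UNIV u"
  shows "(prim u has_real_derivative u t) (at t)"
proof -
  define T where "T = \<bar>t\<bar> + 1"
  have cont: "continuous_on A u" for A using assms continuous_on_subset by blast
  have int: "u integrable_on {x..y}" for x y using integrable_continuous_real[OF cont] .
  have "((\<lambda>x. integral {- T..x} u) has_real_derivative u t) (at t within {- T..T})"
    by (rule integral_has_real_derivative[OF cont]) (auto simp: T_def)
  moreover have "at t within {- T..T} = at t"
    by (rule at_within_interior) (auto simp: T_def interior_atLeastAtMost_real)
  ultimately have "((\<lambda>x. integral {- T..x} u - integral {- T..0} u) has_real_derivative u t) (at t)"
    by (auto intro!: derivative_eq_intros)
  moreover have "integral {- T..x} u - integral {- T..0} u = prim u x" if "x \<in> {- T<..<T}" for x
  proof (cases "0 \<le> x")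
    case True
    then have "integral {- T..0} u + integral {0..x} u = integral {- T..x} u"
      by (intro Henstock_Kurzweil_Integration.integral_combine int) (auto simp: T_def)
    moreover have "integral {x..0} u = 0" using True by (cases "x = 0") auto
    ultimately show ?thesis by (simp add: prim_def)
  next
    case False
    then have "integral {- T..x} u + integral {x..0} u = integral {- T..0} u"
      using that by (intro Henstock_Kurzweil_Integration.integral_combine int) auto
    then show ?thesis using False by (simp add: prim_def)
  qed
  ultimately show ?thesis
    by (elim has_field_derivative_transform_within_open[where S = "{- T<..<T}"])
      (auto simp: T_def)
qed

lemma prim_tendsto:
  assumes "\<And>n. continuous_on UNIV (u n)" "\<And>n x. \<bar>u n x\<bar> \<le> B" "\<And>x. (\<lambda>n. u n x) \<longlonglongrightarrow> v x"
  shows "(\<lambda>n. prim (u n) t) \<longlonglongrightarrow> prim v t"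
proof -
  have "(\<lambda>n. integral {x..y} (u n)) \<longlonglongrightarrow> integral {x..y} v" for x y
    by (rule dominated_convergence(2)[where h = "\<lambda>_. B"])
      (use assms in \<open>auto intro!: integrable_continuous_real continuous_on_subset[OF assms(1)]\<close>)
  then show ?thesis unfolding prim_def by (intro tendsto_diff)
qed

text \<open>
  Momenta are cut off below at \<open>- P\<close>. The cutoff bounds the speed towards the past by a constant
  less than 1, so that a retarded time exists for every time.
\<close>

definition traj :: "real \<Rightarrow> real \<Rightarrow> (real \<Rightarrow> real) \<Rightarrow> real \<Rightarrow> real" where
  "traj P x \<alpha> t = x + prim (\<lambda>t. vel (max (- P) (\<alpha> t))) t"

text \<open>The emission time \<open>s\<close> of the signal received at \<open>t\<close>, from
  \<open>s + B s = t - A t\<close>. With \<open>B = - b\<close> this is the retarded time equation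
  with the absolute value removed, which is correct when \<open>A t + B s \<ge> 0\<close>. For
  continuous \<open>\<beta>\<close> the map inverted here is a bijection.\<close>

definition signal :: "real \<Rightarrow> real \<Rightarrow> real \<Rightarrow> (real \<Rightarrow> real) \<Rightarrow> (real \<Rightarrow> real) \<Rightarrow> real \<Rightarrow> real" where
  "signal P x y \<alpha> \<beta> t = inv (\<lambda>s. s + traj P y \<beta> s) (t - traj P x \<alpha> t)"

definition cutoff_force ::
  "real \<Rightarrow> real \<Rightarrow> real \<Rightarrow> real \<Rightarrow> real \<Rightarrow> (real \<Rightarrow> real) \<Rightarrow> (real \<Rightarrow> real) \<Rightarrow> real \<Rightarrow> real" where
  "cutoff_force \<kappa> P \<delta> x y \<alpha> \<beta> t =
     \<kappa> * sigma (vel (max (- P) (\<beta> (signal P x y \<alpha> \<beta> t)))) / (max \<delta> (t - signal P x y \<alpha> \<beta> t))\<^sup>2"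

lemma traj_0 [simp]: "traj P x \<alpha> 0 = x"
  by (simp add: traj_def)

lemma has_real_derivative_traj:
  assumes "continuous_on UNIV \<alpha>"
  shows "(traj P x \<alpha> has_real_derivative vel (max (- P) (\<alpha> t))) (at t)"
proof -
  have "continuous_on UNIV (\<lambda>t. vel (max (- P) (\<alpha> t)))" by (intro continuous_intros assms)
  from DERIV_add[OF DERIV_const has_real_derivative_prim[OF this]]
  show ?thesis by (simp add: traj_def[abs_def])
qed

lemma traj_increment:
  assumes "continuous_on UNIV \<alpha>" "s \<le> t"
  shows "vel (- P) * (t - s) \<le> traj P x \<alpha> t - traj P x \<alpha> s" "traj P x \<alpha> t - traj P x \<alpha> s \<le> t - s"
proof -
  note d = has_real_derivative_traj[OF assms(1)]
  have "traj P x \<alpha> s - vel (- P) * s \<le> traj P x \<alpha> t - vel (- P) * t"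
    by (rule DERIV_nonneg_imp_nondecreasing[OF assms(2)])
      (intro exI conjI, (rule derivative_intros d DERIV_cmult DERIV_ident)+, simp add: vel_mono)
  then show "vel (- P) * (t - s) \<le> traj P x \<alpha> t - traj P x \<alpha> s" by (simp add: right_diff_distrib)
  have "t - traj P x \<alpha> t \<ge> s - traj P x \<alpha> s"
    by (rule DERIV_nonneg_imp_nondecreasing[OF assms(2)])
      (intro exI conjI, (rule derivative_intros d DERIV_ident)+, use vel_less in \<open>auto intro: less_imp_le\<close>)
  then show "traj P x \<alpha> t - traj P x \<alpha> s \<le> t - s" by simp
qed

lemma traj_lipschitz:
  assumes "continuous_on UNIV \<alpha>"
  shows "\<bar>traj P x \<alpha> t - traj P x \<alpha> s\<bar> \<le> \<bar>t - s\<bar>"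
proof -
  have "\<bar>traj P x \<alpha> t - traj P x \<alpha> s\<bar> \<le> t - s" if "s \<le> t" for s t
  proof -
    have "(- 1) * (t - s) \<le> vel (- P) * (t - s)"
      using vel_greater[of "- P"] that by (intro mult_right_mono) auto
    then show ?thesis using traj_increment[OF assms that] by (smt (verit))
  qed
  from this[of s t] this[of t s] show ?thesis by (cases "s \<le> t") auto
qed

text \<open>The momentum cutoff gives the light cone coordinate a slope of at least
  \<open>1 + vel (- P) > 0\<close>, independent of \<open>\<beta>\<close>. This is what makes its
  inverse Lipschitz and the signal times stable under limits.\<close>

lemma light_cone_increment:
  assumes "continuous_on UNIV \<beta>"
  shows "(1 + vel (- P)) * \<bar>t - s\<bar> \<le> \<bar>(t + traj P y \<beta> t) - (s + traj P y \<beta> s)\<bar>"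
proof -
  have "(1 + vel (- P)) * (t - s) \<le> (t + traj P y \<beta> t) - (s + traj P y \<beta> s)" if "s \<le> t" for s t
    using traj_increment(1)[OF assms that] by (simp add: distrib_right)
  from this[of s t] this[of t s] show ?thesis by (cases "s \<le> t") auto
qed

lemma light_cone_strict_mono:
  assumes "continuous_on UNIV \<beta>" "s < t"
  shows "s + traj P y \<beta> s < t + traj P y \<beta> t"
proof -
  have "0 < (1 + vel (- P)) * (t - s)" using vel_greater[of "- P"] assms by simp
  then show ?thesis using traj_increment(1)[OF assms(1), of s t P y] assms(2)
    by (simp add: distrib_right)
qed

lemma light_cone_bij:
  assumes "continuous_on UNIV \<beta>"
  shows "bij (\<lambda>s. s + traj P y \<beta> s)"
proof (rule bijI)
  let ?G = "\<lambda>s. s + traj P y \<beta> s"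
  show "inj ?G"
    using light_cone_strict_mono[OF assms] by (intro linorder_injI) (metis less_irrefl)
  have "\<exists>s. z = ?G s" for z
  proof -
    have c: "1 + vel (- P) > 0" using vel_greater[of "- P"] by simp
    define T where "T = \<bar>z - y\<bar> / (1 + vel (- P))"
    have T: "T \<ge> 0" "(1 + vel (- P)) * T = \<bar>z - y\<bar>" using c by (auto simp: T_def)
    have "(1 + vel (- P)) * T \<le> ?G T - ?G 0" "(1 + vel (- P)) * T \<le> ?G 0 - ?G (- T)"
      using traj_increment(1)[OF assms, of 0 T P y] traj_increment(1)[OF assms, of "- T" 0 P y] T(1)
      by (auto simp: distrib_right)
    then have "?G (- T) \<le> z" "z \<le> ?G T" using T(2) by auto
    moreover have "continuous_on {- T..T} ?G"
      by (intro continuous_intros 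
        DERIV_continuous_on[OF has_field_derivative_at_within[OF has_real_derivative_traj[OF assms]]])
    ultimately show "\<exists>s. z = ?G s" using IVT'[of ?G "- T" z T] T(1) by auto
  qed
  then show "surj ?G" by (auto simp: surj_def)
qed

lemma signal_eq:
  assumes "continuous_on UNIV \<beta>"
  shows "signal P x y \<alpha> \<beta> t + traj P y \<beta> (signal P x y \<alpha> \<beta> t) = t - traj P x \<alpha> t"
  using surj_f_inv_f[OF bij_is_surj[OF light_cone_bij[OF assms]]] unfolding signal_def by fast

lemma has_real_derivative_signal:
  assumes "continuous_on UNIV \<alpha>" "continuous_on UNIV \<beta>"
  shows "(signal P x y \<alpha> \<beta> has_real_derivative
    (1 - vel (max (- P) (\<alpha> t))) / (1 + vel (max (- P) (\<beta> (signal P x y \<alpha> \<beta> t))))) (at t)"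
proof -
  let ?G = "\<lambda>s. s + traj P y \<beta> s"
  let ?g = "inv ?G"
  let ?z = "t - traj P x \<alpha> t"
  have c: "1 + vel (- P) > 0" using vel_greater[of "- P"] by simp
  have Gg: "?G (?g z) = z" for z
    using surj_f_inv_f[OF bij_is_surj[OF light_cone_bij[OF assms(2)]]] by fast
  have "(1 / (1 + vel (- P)))-lipschitz_on UNIV ?g"
  proof (rule lipschitz_onI)
    fix z z'
    have "(1 + vel (- P)) * \<bar>?g z - ?g z'\<bar> \<le> \<bar>z - z'\<bar>"
      using light_cone_increment[OF assms(2), of P "?g z" "?g z'" y] unfolding Gg .
    then show "dist (?g z) (?g z') \<le> 1 / (1 + vel (- P)) * dist z z'"
      using c by (simp add: dist_real_def field_simps)
  qed (use c in auto)
  then have "isCont ?g ?z"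
    using lipschitz_on_continuous_on continuous_on_eq_continuous_at open_UNIV by blast
  moreover have "(?G has_real_derivative 1 + vel (max (- P) (\<beta> (?g ?z)))) (at (?g ?z))"
    by (intro derivative_intros has_real_derivative_traj assms)
  ultimately have "(?g has_real_derivative inverse (1 + vel (max (- P) (\<beta> (?g ?z))))) (at ?z)"
    using vel_greater[of "max (- P) (\<beta> (?g ?z))"] Gg
    by (intro DERIV_inverse_function[where a = "?z - 1" and b = "?z + 1"]) auto
  moreover have "((\<lambda>t. t - traj P x \<alpha> t) has_real_derivative 1 - vel (max (- P) (\<alpha> t))) (at t)"
    by (intro derivative_intros has_real_derivative_traj assms)
  ultimately show ?thesis
    unfolding signal_def[abs_def] by (auto dest: DERIV_chain2 simp: divide_inverse mult.commute)
qed

section \<open>Continuous dependence on the momenta\<close>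

lemma traj_tendsto:
  assumes "\<And>n. \<alpha> n \<in> slopes M a" "\<And>t. (\<lambda>n. \<alpha> n t) \<longlonglongrightarrow> \<alpha>' t" "\<tau> \<longlonglongrightarrow> t"
  shows "(\<lambda>n. traj P x (\<alpha> n) (\<tau> n)) \<longlonglongrightarrow> traj P x \<alpha>' t"
proof -
  note c = slopes_continuous[OF assms(1)]
  have z: "(\<lambda>n. \<bar>\<tau> n - t\<bar>) \<longlonglongrightarrow> 0"
    using tendsto_rabs_zero[OF LIM_zero[OF assms(3)]] .
  have "(\<lambda>n. traj P x (\<alpha> n) (\<tau> n) - traj P x (\<alpha> n) t) \<longlonglongrightarrow> 0"
    by (rule Lim_null_comparison[OF always_eventually z]) (simp add: traj_lipschitz[OF c])
  moreover have "(\<lambda>n. traj P x (\<alpha> n) t) \<longlonglongrightarrow> traj P x \<alpha>' t"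
    unfolding traj_def
  proof (intro tendsto_add tendsto_const prim_tendsto)
    show "continuous_on UNIV (\<lambda>t. vel (max (- P) (\<alpha> n t)))" for n by (intro continuous_intros c)
    show "\<bar>vel (max (- P) (\<alpha> n t))\<bar> \<le> 1" for n t using abs_vel_less by (intro less_imp_le)
    show "(\<lambda>n. vel (max (- P) (\<alpha> n t))) \<longlonglongrightarrow> vel (max (- P) (\<alpha>' t))" for t
      by (intro tendsto_intros assms(2))
  qed
  ultimately show ?thesis using tendsto_add by fastforce
qed

lemma signal_tendsto:
  assumes "\<And>n. \<alpha> n \<in> slopes M a" "\<And>t. (\<lambda>n. \<alpha> n t) \<longlonglongrightarrow> \<alpha>' t" "\<tau> \<longlonglongrightarrow> t"
    and "\<And>n. \<beta> n \<in> slopes M b" "\<And>t. (\<lambda>n. \<beta> n t) \<longlonglongrightarrow> \<beta>' t"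
  shows "(\<lambda>n. signal P x y (\<alpha> n) (\<beta> n) (\<tau> n)) \<longlonglongrightarrow> signal P x y \<alpha>' \<beta>' t"
proof -
  let ?s = "signal P x y \<alpha>' \<beta>' t" and ?sn = "\<lambda>n. signal P x y (\<alpha> n) (\<beta> n) (\<tau> n)"
  note c = slopes_continuous[OF assms(4)]
  have c': "continuous_on UNIV \<beta>'" using slopes_limit[OF assms(4,5)] by (rule slopes_continuous)
  have pos: "1 + vel (- P) > 0" using vel_greater[of "- P"] by simp
  \<comment> \<open>\<open>d n\<close> is the defect of the limiting signal time in the
    \<open>n\<close>-th equation. It tends to 0, and the uniform slope of the light cone coordinate
    bounds the error of the signal time by a multiple of it.\<close>
  define d where "d n = (\<tau> n - traj P x (\<alpha> n) (\<tau> n)) - (?s + traj P y (\<beta> n) ?s)" for n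
  have "d \<longlonglongrightarrow> (t - traj P x \<alpha>' t) - (?s + traj P y \<beta>' ?s)"
    unfolding d_def
    by (intro tendsto_diff tendsto_add tendsto_const assms(3) traj_tendsto[OF assms(1-3)]
        traj_tendsto[OF assms(4,5) tendsto_const])
  then have d: "(\<lambda>n. \<bar>d n\<bar> / (1 + vel (- P))) \<longlonglongrightarrow> 0"
    unfolding signal_eq[OF c'] using tendsto_divide[OF tendsto_rabs_zero tendsto_const, of d sequentially] pos
    by fastforce
  have "\<bar>?sn n - ?s\<bar> \<le> \<bar>d n\<bar> / (1 + vel (- P))" for n
  proof -
    have "(1 + vel (- P)) * \<bar>?sn n - ?s\<bar> \<le> \<bar>d n\<bar>"
      using light_cone_increment[OF c, of P "?sn n" ?s y n] unfolding signal_eq[OF c] d_def .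
    then show ?thesis using pos by (simp add: field_simps)
  qed
  then have "(\<lambda>n. ?sn n - ?s) \<longlonglongrightarrow> 0"
    by (intro Lim_null_comparison[OF always_eventually d]) auto
  then show ?thesis by (simp add: LIM_zero_iff)
qed

lemma cutoff_force_tendsto:
  assumes "\<And>n. \<alpha> n \<in> slopes M a" "\<And>t. (\<lambda>n. \<alpha> n t) \<longlonglongrightarrow> \<alpha>' t" "\<tau> \<longlonglongrightarrow> t"
    and "\<And>n. \<beta> n \<in> slopes M b" "\<And>t. (\<lambda>n. \<beta> n t) \<longlonglongrightarrow> \<beta>' t" and "\<delta> > 0"
  shows "(\<lambda>n. cutoff_force \<kappa> P \<delta> x y (\<alpha> n) (\<beta> n) (\<tau> n)) \<longlonglongrightarrow> cutoff_force \<kappa> P \<delta> x y \<alpha>' \<beta>' t"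
proof -
  note s = signal_tendsto[OF assms(1-5)]
  show ?thesis
    unfolding cutoff_force_def sigma_def
  proof (intro tendsto_intros s assms(3) slopes_tendsto[OF assms(4,5) s])
    let ?b = "max (- P) (\<beta>' (signal P x y \<alpha>' \<beta>' t))"
    show "1 + vel ?b \<noteq> 0" using vel_greater[of ?b] by simp
    show "(max \<delta> (t - signal P x y \<alpha>' \<beta>' t))\<^sup>2 \<noteq> 0" using \<open>\<delta> > 0\<close> by simp
  qed
qed

lemma sigma_vel_pos: "sigma (vel p) > 0"
  using vel_less[of p] vel_greater[of p] by (simp add: sigma_def)

lemma cutoff_force_bounds:
  assumes "\<kappa> > 0" "\<delta> > 0"
  shows "0 \<le> cutoff_force \<kappa> P \<delta> x y \<alpha> \<beta> t"
    and "cutoff_force \<kappa> P \<delta> x y \<alpha> \<beta> t \<le> \<kappa> * sigma (vel (- P)) / \<delta>\<^sup>2"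
proof -
  let ?b = "max (- P) (\<beta> (signal P x y \<alpha> \<beta> t))"
  show "0 \<le> cutoff_force \<kappa> P \<delta> x y \<alpha> \<beta> t"
    unfolding cutoff_force_def using assms(1) sigma_vel_pos[of ?b] by simp
  have v: "vel (- P) \<le> vel ?b" by (intro vel_mono) auto
  have "sigma (vel ?b) \<le> sigma (vel (- P))"
    unfolding sigma_def using v vel_greater[of "- P"] vel_less[of "- P"] vel_less[of ?b]
    by (intro frac_le) auto
  then show "cutoff_force \<kappa> P \<delta> x y \<alpha> \<beta> t \<le> \<kappa> * sigma (vel (- P)) / \<delta>\<^sup>2"
    unfolding cutoff_force_def using assms sigma_vel_pos[of ?b] sigma_vel_pos[of "- P"]
    by (intro frac_le mult_left_mono power_mono) auto
qed

subsection \<open>Smoothness\<close>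

text \<open>The class of \<open>n\<close> times continuously differentiable functions. Bootstrapping
  gains one order per round, so finite orders are needed; naming the derivative existentially avoids
  iterating \<open>deriv\<close> in the closure lemmas.\<close>

primrec C_diff :: "nat \<Rightarrow> (real \<Rightarrow> real) \<Rightarrow> bool" where
  "C_diff 0 f = continuous_on UNIV f"
| "C_diff (Suc n) f = (\<exists>f'. (\<forall>t. (f has_real_derivative f' t) (at t)) \<and> C_diff n f')"

lemma C_diff_SucI: "(\<And>t. (f has_real_derivative f' t) (at t)) \<Longrightarrow> C_diff n f' \<Longrightarrow> C_diff (Suc n) f"
  by auto

lemma C_diff_continuous: "C_diff n f \<Longrightarrow> continuous_on UNIV f"
  by (cases n) (auto intro: continuous_at_imp_continuous_on DERIV_isCont)

lemma C_diff_Suc_imp: "C_diff (Suc n) f \<Longrightarrow> C_diff n f"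
proof (induction n arbitrary: f)
  case 0
  then show ?case using C_diff_continuous[of "Suc 0" f] by simp
next
  case (Suc n)
  then obtain f' where f': "\<And>t. (f has_real_derivative f' t) (at t)" "C_diff (Suc n) f'"
    unfolding C_diff.simps(2)[of "Suc n"] by blast
  show ?case using f'(1) Suc.IH[OF f'(2)] by (rule C_diff_SucI)
qed

lemma C_diff_imp_smooth:
  assumes "\<And>n. C_diff n f"
  shows "smooth_real f"
proof -
  have "C_diff k ((deriv ^^ n) f)" if "C_diff (n + k) f" for n k
    using that
  proof (induction n arbitrary: f)
    case (Suc n)
    then obtain f' where f': "\<And>t. (f has_real_derivative f' t) (at t)" "C_diff (n + k) f'"
      by auto
    have "deriv f = f'" using f'(1) by (intro ext DERIV_imp_deriv)
    then show ?case using Suc.IH[OF f'(2)] by (simp add: funpow_swap1[of deriv] del: funpow.simps add: funpow.simps(2)[of n deriv])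
  qed simp
  from this[of _ 1] have "C_diff (Suc 0) ((deriv ^^ n) f)" for n using assms by simp
  then show ?thesis by (auto simp: smooth_real_def field_differentiable_def)
qed

lemma C_diff_const: "C_diff n (\<lambda>_. c)"
  by (induction n arbitrary: c) (auto intro!: exI[of _ "\<lambda>_. 0"])

lemma C_diff_ident: "C_diff n (\<lambda>x. x)"
  by (cases n) (auto intro!: exI[of _ "\<lambda>_. 1"] C_diff_const)

lemma C_diff_add: "C_diff n f \<Longrightarrow> C_diff n g \<Longrightarrow> C_diff n (\<lambda>x. f x + g x)"
proof (induction n arbitrary: f g)
  case (Suc n)
  then obtain f' g' where "\<And>t. (f has_real_derivative f' t) (at t)" "C_diff n f'"
    "\<And>t. (g has_real_derivative g' t) (at t)" "C_diff n g'" by auto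
  then show ?case
    using Suc.IH by (intro C_diff_SucI[of _ "\<lambda>x. f' x + g' x"]) (auto intro!: derivative_intros)
qed (auto intro: continuous_intros)

lemma C_diff_mult: "C_diff n f \<Longrightarrow> C_diff n g \<Longrightarrow> C_diff n (\<lambda>x. f x * g x)"
proof (induction n arbitrary: f g)
  case (Suc n)
  then obtain f' g' where *: "\<And>t. (f has_real_derivative f' t) (at t)" "C_diff n f'"
    "\<And>t. (g has_real_derivative g' t) (at t)" "C_diff n g'" by auto
  have "C_diff n (\<lambda>x. f' x * g x + g' x * f x)"
    using *(2,4) Suc.prems[THEN C_diff_Suc_imp] by (intro C_diff_add Suc.IH)
  moreover have "((\<lambda>x. f x * g x) has_real_derivative f' t * g t + g' t * f t) (at t)" for t
    by (intro DERIV_mult *)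
  ultimately show ?case by (intro C_diff_SucI)
qed (auto intro: continuous_intros)

lemma C_diff_diff: "C_diff n f \<Longrightarrow> C_diff n g \<Longrightarrow> C_diff n (\<lambda>x. f x - g x)"
  using C_diff_add[OF _ C_diff_mult[OF C_diff_const[of n "- 1"]], of f g] by simp

lemma C_diff_compose: "C_diff n f \<Longrightarrow> C_diff n g \<Longrightarrow> C_diff n (\<lambda>x. f (g x))"
proof (induction n arbitrary: f g)
  case 0
  then show ?case by (auto intro: continuous_on_compose2)
next
  case (Suc n)
  then obtain f' g' where *: "\<And>t. (f has_real_derivative f' t) (at t)" "C_diff n f'"
    "\<And>t. (g has_real_derivative g' t) (at t)" "C_diff n g'" by auto
  have "C_diff n (\<lambda>x. f' (g x) * g' x)"
    by (rule C_diff_mult[OF Suc.IH[OF *(2) C_diff_Suc_imp[OF Suc.prems(2)]] *(4)])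
  with DERIV_chain2[OF *(1,3)] show ?case by (rule C_diff_SucI)
qed

lemma C_diff_inverse: "C_diff n f \<Longrightarrow> (\<And>x. f x \<noteq> 0) \<Longrightarrow> C_diff n (\<lambda>x. inverse (f x))"
proof (induction n)
  case (Suc n)
  then obtain f' where *: "\<And>t. (f has_real_derivative f' t) (at t)" "C_diff n f'" by auto
  have "C_diff n (\<lambda>x. (- 1) * (inverse (f x) * f' x * inverse (f x)))"
    using *(2) Suc.IH[OF C_diff_Suc_imp] Suc.prems by (intro C_diff_mult C_diff_const) auto
  then show ?case
    using DERIV_inverse'[OF *(1) Suc.prems(2)] by (intro C_diff_SucI) (auto simp: mult.assoc)
qed (auto intro: continuous_intros)

lemma C_diff_divide: "C_diff n f \<Longrightarrow> C_diff n g \<Longrightarrow> (\<And>x. g x \<noteq> 0) \<Longrightarrow> C_diff n (\<lambda>x. f x / g x)"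
  unfolding divide_inverse by (intro C_diff_mult C_diff_inverse)

lemma C_diff_sqrt: "C_diff n f \<Longrightarrow> (\<And>x. f x > 0) \<Longrightarrow> C_diff n (\<lambda>x. sqrt (f x))"
proof (induction n)
  case (Suc n)
  then obtain f' where *: "\<And>t. (f has_real_derivative f' t) (at t)" "C_diff n f'" by auto
  have "C_diff n (\<lambda>x. f' x / (2 * sqrt (f x)))"
    using *(2) Suc.IH[OF C_diff_Suc_imp] Suc.prems less_imp_neq[OF Suc.prems(2)]
    by (intro C_diff_divide C_diff_mult C_diff_const) auto
  moreover have "((\<lambda>x. sqrt (f x)) has_real_derivative f' t / (2 * sqrt (f t))) (at t)" for t
    using DERIV_chain2[OF DERIV_real_sqrt *(1), OF Suc.prems(2)] by (simp add: field_simps)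
  ultimately show ?case by (intro C_diff_SucI)
qed (auto intro: continuous_intros)

lemma C_diff_vel: "C_diff n vel"
proof -
  have *: "C_diff n (\<lambda>x. 1 + x\<^sup>2)"
    unfolding power2_eq_square by (rule C_diff_add[OF C_diff_const C_diff_mult[OF C_diff_ident C_diff_ident]])
  have "sqrt (1 + x\<^sup>2) \<noteq> 0" for x :: real using one_plus_square_pos[of x] by simp
  then show ?thesis unfolding vel_def[abs_def]
    by (rule C_diff_divide[OF C_diff_ident C_diff_sqrt[OF * one_plus_square_pos]])
qed

lemmas C_diff_intros =
  C_diff_add C_diff_diff C_diff_mult C_diff_divide C_diff_const C_diff_compose[OF C_diff_vel]

subsection \<open>Global solutions\<close>

text \<open>The order of quantifiers matters: every small \<open>\<delta>\<close> is admissible, and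
  then every large \<open>P\<close>, with a threshold depending on \<open>\<delta>\<close>. Two
  particles with different thresholds can thus share one pair of cutoffs.\<close>

lemma a_priori_cutoffs:
  assumes "\<kappa> > 0" "r\<^sub>0 > 0"
  obtains \<delta>\<^sub>0 where "\<delta>\<^sub>0 > 0"
    "\<And>\<delta>. 0 < \<delta> \<Longrightarrow> \<delta> \<le> \<delta>\<^sub>0 \<Longrightarrow> \<exists>P\<^sub>0. \<forall>P\<ge>P\<^sub>0. \<forall>\<alpha> \<omega> s.
      r\<^sub>0 \<le> - s 0 \<and> \<alpha> 0 = \<alpha>\<^sub>0 \<and>
      (\<forall>t. (\<alpha> has_real_derivative \<kappa> * sigma (\<omega> t) / (max \<delta> (t - s t))\<^sup>2) (at t)) \<and>
      (\<forall>t. (s has_real_derivative (1 - vel (max (- P) (\<alpha> t))) / (1 + \<omega> t)) (at t)) \<and>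
      (\<forall>t. \<bar>\<omega> t\<bar> < 1) \<and> (\<forall>t\<le>0. \<omega> t \<le> vel \<beta>\<^sub>0) \<longrightarrow>
      (\<forall>t. \<delta> < t - s t \<and> - P < \<alpha> t)"
proof -
  define c where "c = (1 + vel \<beta>\<^sub>0) / (\<kappa> * (1 - vel \<beta>\<^sub>0) * (1 - vel \<alpha>\<^sub>0))"
  define \<alpha>\<^sub>1 where "\<alpha>\<^sub>1 = min \<alpha>\<^sub>0 (- \<beta>\<^sub>0 - 1)"
  define C where "C = 2 * \<kappa> * (1 - vel \<alpha>\<^sub>1) / (- vel \<beta>\<^sub>0 - vel \<alpha>\<^sub>1)"
  define K where "K = 1 / r\<^sub>0 + c * redshift (- \<beta>\<^sub>0) + redshift \<alpha>\<^sub>0 / (\<kappa> * (1 + vel \<alpha>\<^sub>0))"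
  show ?thesis
  proof (rule that[of "1 / (\<bar>K\<bar> + 1)"])
    fix \<delta> :: real assume \<delta>: "0 < \<delta>" "\<delta> \<le> 1 / (\<bar>K\<bar> + 1)"
    then have "\<bar>K\<bar> + 1 \<le> 1 / \<delta>" by (simp add: field_simps)
    then have K: "K < 1 / \<delta>" by linarith
    show "\<exists>P\<^sub>0. \<forall>P\<ge>P\<^sub>0. \<forall>\<alpha> \<omega> s.
      r\<^sub>0 \<le> - s 0 \<and> \<alpha> 0 = \<alpha>\<^sub>0 \<and>
      (\<forall>t. (\<alpha> has_real_derivative \<kappa> * sigma (\<omega> t) / (max \<delta> (t - s t))\<^sup>2) (at t)) \<and>
      (\<forall>t. (s has_real_derivative (1 - vel (max (- P) (\<alpha> t))) / (1 + \<omega> t)) (at t)) \<and>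
      (\<forall>t. \<bar>\<omega> t\<bar> < 1) \<and> (\<forall>t\<le>0. \<omega> t \<le> vel \<beta>\<^sub>0) \<longrightarrow>
      (\<forall>t. \<delta> < t - s t \<and> - P < \<alpha> t)"
    proof (intro exI[of _ "\<bar>redshift \<alpha>\<^sub>1 + C / \<delta>\<bar> + \<bar>\<alpha>\<^sub>1\<bar> + 1"] allI impI)
      fix P \<alpha> \<omega> s t
      assume P: "\<bar>redshift \<alpha>\<^sub>1 + C / \<delta>\<bar> + \<bar>\<alpha>\<^sub>1\<bar> + 1 \<le> P"
      assume *: "r\<^sub>0 \<le> - s 0 \<and> \<alpha> 0 = \<alpha>\<^sub>0 \<and>
        (\<forall>t. (\<alpha> has_real_derivative \<kappa> * sigma (\<omega> t) / (max \<delta> (t - s t))\<^sup>2) (at t)) \<and>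
        (\<forall>t. (s has_real_derivative (1 - vel (max (- P) (\<alpha> t))) / (1 + \<omega> t)) (at t)) \<and>
        (\<forall>t. \<bar>\<omega> t\<bar> < 1) \<and> (\<forall>t\<le>0. \<omega> t \<le> vel \<beta>\<^sub>0)"
      have Pl: "- P < min \<alpha>\<^sub>0 (- \<beta>\<^sub>0 - 1)" "redshift (min \<alpha>\<^sub>0 (- \<beta>\<^sub>0 - 1)) + 2 * \<kappa> *
          (1 - vel (min \<alpha>\<^sub>0 (- \<beta>\<^sub>0 - 1))) / (- vel \<beta>\<^sub>0 - vel (min \<alpha>\<^sub>0 (- \<beta>\<^sub>0 - 1))) / \<delta> < P"
        using P unfolding C_def \<alpha>\<^sub>1_def by linarith+
      show "\<delta> < t - s t \<and> - P < \<alpha> t"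
        using a_priori_bounds[OF assms(1) \<delta>(1) assms(2), of s \<alpha> \<omega> P \<beta>\<^sub>0 \<alpha>\<^sub>0 t]
          * K[unfolded K_def c_def] Pl by blast
    qed
  qed (simp add: add_nonneg_pos)
qed

text \<open>The distance at time 0 is \<open>- s = x + B s\<close>, and \<open>B s\<close> differs
  from \<open>y\<close> by at most \<open>- s\<close>; hence
  \<open>- 2 * s \<ge> x + y\<close>.\<close>

lemma signal_initial:
  assumes "continuous_on UNIV \<beta>" "x + y > 0"
  shows "(x + y) / 2 \<le> - signal P x y \<alpha> \<beta> 0"
proof -
  let ?s = "signal P x y \<alpha> \<beta> 0"
  have e: "?s + traj P y \<beta> ?s = - x" using signal_eq[OF assms(1), of P x y \<alpha> 0] by simp
  have "?s < 0"
  proof (rule ccontr)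
    assume "\<not> ?s < 0"
    then have "0 = ?s \<or> 0 < ?s" by auto
    then show False using light_cone_strict_mono[OF assms(1), of 0 ?s P y] e assms(2) by auto
  qed
  then show ?thesis using e traj_lipschitz[OF assms(1), of P y 0 ?s] by simp
qed

text \<open>For \<open>t \<le> 0\<close> the value \<open>t - A t\<close> is at most
  \<open>- x\<close>, which is below \<open>y\<close>, the light cone coordinate of the other
  particle at time 0. Monotonicity then bounds the momentum of the emitter by its initial
  value.\<close>

lemma signal_nonpos:
  assumes "continuous_on UNIV \<alpha>" "continuous_on UNIV \<beta>" "x + y > 0" "t \<le> 0"
  shows "signal P x y \<alpha> \<beta> t \<le> 0"
proof (rule ccontr)
  let ?s = "signal P x y \<alpha> \<beta> t"
  assume "\<not> ?s \<le> 0"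
  then have "y < ?s + traj P y \<beta> ?s" using light_cone_strict_mono[OF assms(2), of 0 ?s P y] by simp
  then show False
    using traj_lipschitz[OF assms(1), of P x t 0] assms(3,4) unfolding signal_eq[OF assms(2)] by simp
qed

lemma symmetric_solution:
  assumes \<kappa>: "\<kappa>\<^sub>a > 0" "\<kappa>\<^sub>b > 0" and xy: "x + y > 0"
  obtains \<alpha> \<beta> A B s r :: "real \<Rightarrow> real" where
    "\<alpha> 0 = \<alpha>\<^sub>0" "\<beta> 0 = \<beta>\<^sub>0" "A 0 = x" "B 0 = y"
    "\<And>t. (A has_real_derivative vel (\<alpha> t)) (at t)"
    "\<And>t. (B has_real_derivative vel (\<beta> t)) (at t)"
    "\<And>t. s t < t" "\<And>t. s t + B (s t) = t - A t"
    "\<And>t. r t < t" "\<And>t. r t + A (r t) = t - B t"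
    "\<And>t. (s has_real_derivative (1 - vel (\<alpha> t)) / (1 + vel (\<beta> (s t)))) (at t)"
    "\<And>t. (r has_real_derivative (1 - vel (\<beta> t)) / (1 + vel (\<alpha> (r t)))) (at t)"
    "\<And>t. (\<alpha> has_real_derivative \<kappa>\<^sub>a * sigma (vel (\<beta> (s t))) / (t - s t)\<^sup>2) (at t)"
    "\<And>t. (\<beta> has_real_derivative \<kappa>\<^sub>b * sigma (vel (\<alpha> (r t))) / (t - r t)\<^sup>2) (at t)"
proof -
  define r\<^sub>0 where "r\<^sub>0 = (x + y) / 2"
  have r0: "r\<^sub>0 > 0" using xy by (simp add: r\<^sub>0_def)
  obtain \<delta>\<^sub>a where \<delta>a: "\<delta>\<^sub>a > 0"
    "\<And>\<delta>. 0 < \<delta> \<Longrightarrow> \<delta> \<le> \<delta>\<^sub>a \<Longrightarrow> \<exists>P\<^sub>0. \<forall>P\<ge>P\<^sub>0. \<forall>\<alpha> \<omega> s.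
      r\<^sub>0 \<le> - s 0 \<and> \<alpha> 0 = \<alpha>\<^sub>0 \<and>
      (\<forall>t. (\<alpha> has_real_derivative \<kappa>\<^sub>a * sigma (\<omega> t) / (max \<delta> (t - s t))\<^sup>2) (at t)) \<and>
      (\<forall>t. (s has_real_derivative (1 - vel (max (- P) (\<alpha> t))) / (1 + \<omega> t)) (at t)) \<and>
      (\<forall>t. \<bar>\<omega> t\<bar> < 1) \<and> (\<forall>t\<le>0. \<omega> t \<le> vel \<beta>\<^sub>0) \<longrightarrow>
      (\<forall>t. \<delta> < t - s t \<and> - P < \<alpha> t)"
    by (rule a_priori_cutoffs[OF \<kappa>(1) r0, of \<alpha>\<^sub>0 \<beta>\<^sub>0]) blast
  obtain \<delta>\<^sub>b where \<delta>b: "\<delta>\<^sub>b > 0"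
    "\<And>\<delta>. 0 < \<delta> \<Longrightarrow> \<delta> \<le> \<delta>\<^sub>b \<Longrightarrow> \<exists>P\<^sub>0. \<forall>P\<ge>P\<^sub>0. \<forall>\<alpha> \<omega> s.
      r\<^sub>0 \<le> - s 0 \<and> \<alpha> 0 = \<beta>\<^sub>0 \<and>
      (\<forall>t. (\<alpha> has_real_derivative \<kappa>\<^sub>b * sigma (\<omega> t) / (max \<delta> (t - s t))\<^sup>2) (at t)) \<and>
      (\<forall>t. (s has_real_derivative (1 - vel (max (- P) (\<alpha> t))) / (1 + \<omega> t)) (at t)) \<and>
      (\<forall>t. \<bar>\<omega> t\<bar> < 1) \<and> (\<forall>t\<le>0. \<omega> t \<le> vel \<alpha>\<^sub>0) \<longrightarrow>
      (\<forall>t. \<delta> < t - s t \<and> - P < \<alpha> t)"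
    by (rule a_priori_cutoffs[OF \<kappa>(2) r0, of \<beta>\<^sub>0 \<alpha>\<^sub>0]) blast
  define \<delta> where "\<delta> = min \<delta>\<^sub>a \<delta>\<^sub>b"
  have \<delta>: "\<delta> > 0" "\<delta> \<le> \<delta>\<^sub>a" "\<delta> \<le> \<delta>\<^sub>b" using \<delta>a(1) \<delta>b(1) by (auto simp: \<delta>_def)
  obtain P\<^sub>a where Pa: "\<And>P \<alpha> \<omega> s t. P \<ge> P\<^sub>a \<Longrightarrow> r\<^sub>0 \<le> - s 0 \<Longrightarrow> \<alpha> 0 = \<alpha>\<^sub>0 \<Longrightarrow>
      (\<And>t. (\<alpha> has_real_derivative \<kappa>\<^sub>a * sigma (\<omega> t) / (max \<delta> (t - s t))\<^sup>2) (at t)) \<Longrightarrow>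
      (\<And>t. (s has_real_derivative (1 - vel (max (- P) (\<alpha> t))) / (1 + \<omega> t)) (at t)) \<Longrightarrow>
      (\<And>t. \<bar>\<omega> t\<bar> < 1) \<Longrightarrow> (\<And>t. t \<le> 0 \<Longrightarrow> \<omega> t \<le> vel \<beta>\<^sub>0) \<Longrightarrow>
      \<delta> < t - s t \<and> - P < \<alpha> t"
    using \<delta>a(2)[OF \<delta>(1,2)] by blast
  obtain P\<^sub>b where Pb: "\<And>P \<alpha> \<omega> s t. P \<ge> P\<^sub>b \<Longrightarrow> r\<^sub>0 \<le> - s 0 \<Longrightarrow> \<alpha> 0 = \<beta>\<^sub>0 \<Longrightarrow>
      (\<And>t. (\<alpha> has_real_derivative \<kappa>\<^sub>b * sigma (\<omega> t) / (max \<delta> (t - s t))\<^sup>2) (at t)) \<Longrightarrow>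
      (\<And>t. (s has_real_derivative (1 - vel (max (- P) (\<alpha> t))) / (1 + \<omega> t)) (at t)) \<Longrightarrow>
      (\<And>t. \<bar>\<omega> t\<bar> < 1) \<Longrightarrow> (\<And>t. t \<le> 0 \<Longrightarrow> \<omega> t \<le> vel \<alpha>\<^sub>0) \<Longrightarrow>
      \<delta> < t - s t \<and> - P < \<alpha> t"
    using \<delta>b(2)[OF \<delta>(1,3)] by blast
  \<comment> \<open>\<open>P\<close> also dominates \<open>- \<alpha>\<^sub>0\<close> and
    \<open>- \<beta>\<^sub>0\<close>, so that the cutoff leaves the initial momenta
    unchanged.\<close>
  define P where "P = max (max P\<^sub>a P\<^sub>b) (max (- \<alpha>\<^sub>0) (- \<beta>\<^sub>0))"
  have P: "P\<^sub>a \<le> P" "P\<^sub>b \<le> P" "- P \<le> \<alpha>\<^sub>0" "- P \<le> \<beta>\<^sub>0" unfolding P_def by linarith+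
  define M where "M = (\<kappa>\<^sub>a + \<kappa>\<^sub>b) * sigma (vel (- P)) / \<delta>\<^sup>2"
  have Mpos: "M > 0" unfolding M_def using \<kappa> \<delta>(1) sigma_vel_pos[of "- P"] by simp
  have leM: "\<kappa> * sigma (vel (- P)) / \<delta>\<^sup>2 \<le> M" if "\<kappa> \<le> \<kappa>\<^sub>a + \<kappa>\<^sub>b" for \<kappa>
    unfolding M_def using that sigma_vel_pos[of "- P"] by (intro divide_right_mono mult_right_mono) auto
  define c where "c = (\<lambda>k :: nat. if k = 0 then \<alpha>\<^sub>0 else \<beta>\<^sub>0)"
  define F where "F = (\<lambda>\<gamma> (k :: nat). if k = 0 then cutoff_force \<kappa>\<^sub>a P \<delta> x y (\<gamma> 0) (\<gamma> (1 :: nat))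
    else cutoff_force \<kappa>\<^sub>b P \<delta> y x (\<gamma> 1) (\<gamma> 0))"
  obtain \<gamma> where \<gamma>: "\<And>k. k < 2 \<Longrightarrow> \<gamma> k \<in> slopes M (c k)"
    "\<And>k t. k < 2 \<Longrightarrow> (\<gamma> k has_real_derivative F \<gamma> k t) (at t)"
  proof (rule functional_ode_solution[of M 2 c F])
    show "M > 0" by fact
  next
    fix \<gamma> :: "nat \<Rightarrow> real \<Rightarrow> real" and k t
    show "0 \<le> F \<gamma> k t \<and> F \<gamma> k t \<le> M"
      using cutoff_force_bounds[OF \<kappa>(1) \<delta>(1), of P x y "\<gamma> 0" "\<gamma> 1" t] leM[of \<kappa>\<^sub>a]
        cutoff_force_bounds[OF \<kappa>(2) \<delta>(1), of P y x "\<gamma> 1" "\<gamma> 0" t] leM[of \<kappa>\<^sub>b] \<kappa>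
      by (auto simp: F_def)
  next
    fix \<Gamma> :: "nat \<Rightarrow> nat \<Rightarrow> real \<Rightarrow> real" and \<gamma> and \<tau> :: "nat \<Rightarrow> real" and k t
    assume *: "\<And>n l. l < 2 \<Longrightarrow> \<Gamma> n l \<in> slopes M (c l)"
      "\<And>l t. l < 2 \<Longrightarrow> (\<lambda>n. \<Gamma> n l t) \<longlonglongrightarrow> \<gamma> l t" "\<tau> \<longlonglongrightarrow> t" "k < (2 :: nat)"
    have "(\<lambda>n. cutoff_force \<kappa>\<^sub>a P \<delta> x y (\<Gamma> n 0) (\<Gamma> n 1) (\<tau> n)) \<longlonglongrightarrow>
        cutoff_force \<kappa>\<^sub>a P \<delta> x y (\<gamma> 0) (\<gamma> 1) t"
      by (rule cutoff_force_tendsto[OF *(1) *(2) *(3) *(1) *(2) \<delta>(1)]) auto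
    moreover have "(\<lambda>n. cutoff_force \<kappa>\<^sub>b P \<delta> y x (\<Gamma> n 1) (\<Gamma> n 0) (\<tau> n)) \<longlonglongrightarrow>
        cutoff_force \<kappa>\<^sub>b P \<delta> y x (\<gamma> 1) (\<gamma> 0) t"
      by (rule cutoff_force_tendsto[OF *(1) *(2) *(3) *(1) *(2) \<delta>(1)]) auto
    ultimately show "(\<lambda>n. F (\<Gamma> n) k (\<tau> n)) \<longlonglongrightarrow> F \<gamma> k t" by (simp add: F_def)
  qed blast
  define \<alpha> \<beta> where "\<alpha> = \<gamma> 0" and "\<beta> = \<gamma> 1"
  define s r where "s = signal P x y \<alpha> \<beta>" and "r = signal P y x \<beta> \<alpha>"
  have sl: "\<alpha> \<in> slopes M \<alpha>\<^sub>0" "\<beta> \<in> slopes M \<beta>\<^sub>0"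
    using \<gamma>(1)[of 0] \<gamma>(1)[of 1] by (auto simp: \<alpha>_def \<beta>_def c_def)
  note init = slopesD(1)[OF sl(1)] slopesD(1)[OF sl(2)]
  note cont = slopes_continuous[OF sl(1)] slopes_continuous[OF sl(2)]
  have d\<alpha>: "(\<alpha> has_real_derivative \<kappa>\<^sub>a * sigma (vel (max (- P) (\<beta> (s t)))) / (max \<delta> (t - s t))\<^sup>2) (at t)" for t
    using \<gamma>(2)[of 0 t] by (simp add: F_def cutoff_force_def \<alpha>_def \<beta>_def s_def)
  have d\<beta>: "(\<beta> has_real_derivative \<kappa>\<^sub>b * sigma (vel (max (- P) (\<alpha> (r t)))) / (max \<delta> (t - r t))\<^sup>2) (at t)" for t
    using \<gamma>(2)[of 1 t] by (simp add: F_def cutoff_force_def \<alpha>_def \<beta>_def r_def)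
  have ds: "(s has_real_derivative (1 - vel (max (- P) (\<alpha> t))) / (1 + vel (max (- P) (\<beta> (s t))))) (at t)" for t
    unfolding s_def by (rule has_real_derivative_signal[OF cont])
  have dr: "(r has_real_derivative (1 - vel (max (- P) (\<beta> t))) / (1 + vel (max (- P) (\<alpha> (r t))))) (at t)" for t
    unfolding r_def by (rule has_real_derivative_signal[OF cont(2,1)])
  have yx: "y + x > 0" using xy by simp
  have A: "\<delta> < t - s t \<and> - P < \<alpha> t" for t
  proof (rule Pa[OF P(1) _ init(1) d\<alpha> ds])
    show "r\<^sub>0 \<le> - s 0" using signal_initial[OF cont(2) xy] by (simp add: r\<^sub>0_def s_def)
    show "\<bar>vel (max (- P) (\<beta> (s t)))\<bar> < 1" for t by (rule abs_vel_less)
    fix t :: real assume "t \<le> 0"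
    then have "\<beta> (s t) \<le> \<beta>\<^sub>0"
      using slopesD(2)[OF sl(2), of "s t" 0] signal_nonpos[OF cont xy] init by (simp add: s_def)
    then show "vel (max (- P) (\<beta> (s t))) \<le> vel \<beta>\<^sub>0" using P by (intro vel_mono) auto
  qed
  have B: "\<delta> < t - r t \<and> - P < \<beta> t" for t
  proof (rule Pb[OF P(2) _ init(2) d\<beta> dr])
    show "r\<^sub>0 \<le> - r 0" using signal_initial[OF cont(1) yx] by (simp add: r\<^sub>0_def r_def add.commute)
    show "\<bar>vel (max (- P) (\<alpha> (r t)))\<bar> < 1" for t by (rule abs_vel_less)
    fix t :: real assume "t \<le> 0"
    then have "\<alpha> (r t) \<le> \<alpha>\<^sub>0"
      using slopesD(2)[OF sl(1), of "r t" 0] signal_nonpos[OF cont(2,1) yx] init by (simp add: r_def)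
    then show "vel (max (- P) (\<alpha> (r t))) \<le> vel \<alpha>\<^sub>0" using P by (intro vel_mono) auto
  qed
  \<comment> \<open>The a priori bounds make every cutoff inactive, so the fixed point solves the
    original equations.\<close>
  have max_simps: "max (- P) (\<alpha> t) = \<alpha> t" "max (- P) (\<beta> t) = \<beta> t"
    "max \<delta> (t - s t) = t - s t" "max \<delta> (t - r t) = t - r t" for t
    using A[of t] B[of t] by auto
  show ?thesis
  proof (rule that[of \<alpha> \<beta> "traj P x \<alpha>" "traj P y \<beta>" s r])
    show "s t < t" "r t < t" for t using A[of t] B[of t] \<delta>(1) by auto
    show "(traj P x \<alpha> has_real_derivative vel (\<alpha> t)) (at t)" for t
      using has_real_derivative_traj[OF cont(1), of P x t] unfolding max_simps .
    show "(traj P y \<beta> has_real_derivative vel (\<beta> t)) (at t)" for t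
      using has_real_derivative_traj[OF cont(2), of P y t] unfolding max_simps .
    show "s t + traj P y \<beta> (s t) = t - traj P x \<alpha> t" "r t + traj P x \<alpha> (r t) = t - traj P y \<beta> t" for t
      unfolding s_def r_def by (rule signal_eq[OF cont(2)], rule signal_eq[OF cont(1)])
  qed (use init d\<alpha> d\<beta> ds dr in \<open>simp_all only: max_simps traj_0\<close>)
qed

section \<open>Retarded times, regularity and the return to the original coordinates\<close>

text \<open>Two retarded times differ by the difference of two distances from the same point
  \<open>a t\<close>, hence by at most the displacement of \<open>b\<close> in between, which is
  less than the elapsed time.\<close>

lemma is_ret2_unique:
  assumes b: "\<And>t. (b has_real_derivative b' t) (at t)" "\<And>t. \<bar>b' t\<bar> < 1"
    and "is_ret2 a b t s" "is_ret2 a b t u"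
  shows "s = u"
proof (rule ccontr)
  assume "s \<noteq> u"
  have less: "\<bar>b q - b p\<bar> < q - p" if pq: "p < q" for p q
  proof -
    obtain z where "b q - b p = (q - p) * b' z" using MVT2[OF pq, of b b'] b(1) by blast
    then have "\<bar>b q - b p\<bar> = (q - p) * \<bar>b' z\<bar>" using pq by (simp add: abs_mult)
    also have "\<dots> < (q - p) * 1" using b(2) pq by (intro mult_strict_left_mono) auto
    finally show ?thesis by simp
  qed
  show False
    using less[of s u] less[of u s] assms(3,4) \<open>s \<noteq> u\<close> unfolding is_ret2_def by linarith
qed

lemma is_ret1_eq: "is_ret1 a b t s \<longleftrightarrow> is_ret2 b a t s"
  by (simp add: is_ret1_def is_ret2_def abs_minus_commute)

text \<open>The derivatives of \<open>\<alpha>\<close>, \<open>\<beta>\<close>, \<open>s\<close> and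
  \<open>r\<close> are built from these same four functions, so their orders of differentiability
  rise simultaneously. Denominators vanish nowhere because speeds are below 1 and
  \<open>s t\<close>, \<open>r t\<close> are less than \<open>t\<close>.\<close>

lemma symmetric_solution_smooth:
  assumes dA: "\<And>t. (A has_real_derivative vel (\<alpha> t)) (at t)"
    and dB: "\<And>t. (B has_real_derivative vel (\<beta> t)) (at t)"
    and lt: "\<And>t. s t < t" "\<And>t. r t < t"
    and ds: "\<And>t. (s has_real_derivative (1 - vel (\<alpha> t)) / (1 + vel (\<beta> (s t)))) (at t)"
    and dr: "\<And>t. (r has_real_derivative (1 - vel (\<beta> t)) / (1 + vel (\<alpha> (r t)))) (at t)"
    and d\<alpha>: "\<And>t. (\<alpha> has_real_derivative \<kappa>\<^sub>a * sigma (vel (\<beta> (s t))) / (t - s t)\<^sup>2) (at t)"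
    and d\<beta>: "\<And>t. (\<beta> has_real_derivative \<kappa>\<^sub>b * sigma (vel (\<alpha> (r t))) / (t - r t)\<^sup>2) (at t)"
  shows "C_diff n A \<and> C_diff n B"
proof -
  have nz: "1 + vel p \<noteq> 0" for p using vel_greater[of p] by simp
  have nz2: "(t - s t) * (t - s t) \<noteq> 0" "(t - r t) * (t - r t) \<noteq> 0" for t using lt[of t] by auto
  have main: "C_diff n \<alpha> \<and> C_diff n \<beta> \<and> C_diff n s \<and> C_diff n r" for n
  proof (induction n)
    case 0
    have "continuous_on UNIV f" if "\<And>t. (f has_real_derivative f' t) (at t)" for f f' :: "real \<Rightarrow> real"
      using that by (meson DERIV_isCont continuous_at_imp_continuous_on)
    from this[OF d\<alpha>] this[OF d\<beta>] this[OF ds] this[OF dr] show ?case by simp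
  next
    case (Suc n)
    then have IH: "C_diff n \<alpha>" "C_diff n \<beta>" "C_diff n s" "C_diff n r" by auto
    have IH': "C_diff n (\<lambda>t. \<beta> (s t))" "C_diff n (\<lambda>t. \<alpha> (r t))" using IH by (auto intro: C_diff_compose)
    show ?case
    proof (intro conjI)
      show "C_diff (Suc n) \<alpha>"
        by (rule C_diff_SucI[OF d\<alpha>])
          (unfold sigma_def power2_eq_square, intro C_diff_intros C_diff_ident IH IH' nz nz2)
      show "C_diff (Suc n) \<beta>"
        by (rule C_diff_SucI[OF d\<beta>])
          (unfold sigma_def power2_eq_square, intro C_diff_intros C_diff_ident IH IH' nz nz2)
      show "C_diff (Suc n) s"
        by (rule C_diff_SucI[OF ds]) (intro C_diff_intros IH IH' nz)
      show "C_diff (Suc n) r"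
        by (rule C_diff_SucI[OF dr]) (intro C_diff_intros IH IH' nz)
    qed
  qed
  have "C_diff (Suc n) A" "C_diff (Suc n) B"
    by (rule C_diff_SucI[OF dA], intro C_diff_intros, use main in blast)
       (rule C_diff_SucI[OF dB], intro C_diff_intros, use main in blast)
  then show ?thesis by (blast intro: C_diff_Suc_imp)
qed

theorem theorem1p2:
  fixes e\<^sub>a e\<^sub>b m\<^sub>a m\<^sub>b \<kappa>\<^sub>a \<kappa>\<^sub>b a\<^sub>0 b\<^sub>0 va\<^sub>0 vb\<^sub>0 :: real
  assumes "m\<^sub>a > 0" and "m\<^sub>b > 0" and "e\<^sub>a * e\<^sub>b > 0"
    and "\<kappa>\<^sub>a = e\<^sub>a * e\<^sub>b / m\<^sub>a" and "\<kappa>\<^sub>b = e\<^sub>a * e\<^sub>b / m\<^sub>b"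
    and "a\<^sub>0 > b\<^sub>0"
    and "va\<^sub>0 \<in> {-1<..<1}" and "vb\<^sub>0 \<in> {-1<..<1}"
  shows "\<exists>a b. smooth_real a \<and> smooth_real b \<and>
           synge_solution \<kappa>\<^sub>a \<kappa>\<^sub>b a b \<and>
           a 0 = a\<^sub>0 \<and> deriv a 0 = va\<^sub>0 \<and> b 0 = b\<^sub>0 \<and> deriv b 0 = vb\<^sub>0"
proof -
  have \<kappa>: "\<kappa>\<^sub>a > 0" "\<kappa>\<^sub>b > 0" using assms by auto
  have v0: "vel (va\<^sub>0 / sqrt (1 - va\<^sub>0\<^sup>2)) = va\<^sub>0" "vel (- (vb\<^sub>0 / sqrt (1 - vb\<^sub>0\<^sup>2))) = - vb\<^sub>0"
    using vel_momentum[of va\<^sub>0] vel_momentum[of vb\<^sub>0] assms by (simp_all add: vel_minus abs_less_iff)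
  have xy: "a\<^sub>0 + - b\<^sub>0 > 0" using assms by simp
  obtain \<alpha> \<beta> A B s r where init: "\<alpha> 0 = va\<^sub>0 / sqrt (1 - va\<^sub>0\<^sup>2)" "\<beta> 0 = - (vb\<^sub>0 / sqrt (1 - vb\<^sub>0\<^sup>2))"
      "A 0 = a\<^sub>0" "B 0 = - b\<^sub>0"
    and dA: "\<And>t. (A has_real_derivative vel (\<alpha> t)) (at t)"
    and dB: "\<And>t. (B has_real_derivative vel (\<beta> t)) (at t)"
    and s: "\<And>t. s t < t" "\<And>t. s t + B (s t) = t - A t"
    and r: "\<And>t. r t < t" "\<And>t. r t + A (r t) = t - B t"
    and ds: "\<And>t. (s has_real_derivative (1 - vel (\<alpha> t)) / (1 + vel (\<beta> (s t)))) (at t)"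
    and dr: "\<And>t. (r has_real_derivative (1 - vel (\<beta> t)) / (1 + vel (\<alpha> (r t)))) (at t)"
    and d\<alpha>: "\<And>t. (\<alpha> has_real_derivative \<kappa>\<^sub>a * sigma (vel (\<beta> (s t))) / (t - s t)\<^sup>2) (at t)"
    and d\<beta>: "\<And>t. (\<beta> has_real_derivative \<kappa>\<^sub>b * sigma (vel (\<alpha> (r t))) / (t - r t)\<^sup>2) (at t)"
    by (rule symmetric_solution[OF \<kappa> xy]) blast
  define b where "b = (\<lambda>t. - B t)"
  have db: "(b has_real_derivative - vel (\<beta> t)) (at t)" for t
    unfolding b_def by (rule DERIV_minus[OF dB])
  have derivs: "deriv A = (\<lambda>t. vel (\<alpha> t))" "deriv b = (\<lambda>t. - vel (\<beta> t))"
    using dA db by (auto intro!: ext DERIV_imp_deriv)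
  have C: "C_diff n A" "C_diff n B" for n
    using symmetric_solution_smooth[OF dA dB s(1) r(1) ds dr d\<alpha> d\<beta>] by auto
  have smooth: "smooth_real A" "smooth_real b"
    using C_diff_diff[OF C_diff_const[of _ 0] C(2)] by (auto intro!: C_diff_imp_smooth C simp: b_def)
  \<comment> \<open>As an equivalence this settles existence and uniqueness together and evaluates
    \<open>ret1\<close>. The absolute value opens because
    \<open>A (r t) - b t = t - r t > 0\<close>.\<close>
  have is1: "is_ret1 A b t u \<longleftrightarrow> u = r t" for t u
  proof -
    have "is_ret1 A b t (r t)" using r[of t] by (simp add: is_ret1_def b_def abs_if)
    then show ?thesis using is_ret2_unique[OF dA abs_vel_less] unfolding is_ret1_eq by blast
  qed
  have is2: "is_ret2 A b t u \<longleftrightarrow> u = s t" for t u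
  proof -
    have "is_ret2 A b t (s t)" using s[of t] by (simp add: is_ret2_def b_def abs_if)
    then show ?thesis using is_ret2_unique[OF db] abs_vel_less by (metis abs_minus_cancel)
  qed
  have rets: "ret1 A b t = r t" "ret2 A b t = s t" for t
    unfolding ret1_def ret2_def is1 is2 by simp_all
  have dist: "A t - b (s t) = t - s t" "b t - A (r t) = - (t - r t)" for t
    using s(2)[of t] r(2)[of t] by (simp_all add: b_def)
  \<comment> \<open>Reversing the orientation of the second particle turns \<open>rho\<close> into
    \<open>sigma\<close>; this is why both forces have the same form in the mirrored
    coordinates.\<close>
  have rho: "rho (- v) = sigma v" for v by (simp add: rho_def sigma_def)
  have mom: "deriv A u / sqrt (1 - (deriv A u)\<^sup>2) = \<alpha> u" "deriv b u / sqrt (1 - (deriv b u)\<^sup>2) = - \<beta> u" for u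
    unfolding derivs using momentum_vel by simp_all
  have "synge_solution \<kappa>\<^sub>a \<kappa>\<^sub>b A b"
    unfolding synge_solution_def rets dist mom is1 is2
  proof (intro conjI allI)
    fix t
    show "\<bar>deriv A t\<bar> < 1" "\<bar>deriv b t\<bar> < 1" by (simp_all add: derivs abs_vel_less)
    show "t - s t \<noteq> 0" "- (t - r t) \<noteq> 0" using s(1)[of t] r(1)[of t] by auto
    show "(\<alpha> has_real_derivative \<kappa>\<^sub>a * (rho (deriv b (s t)) / (t - s t)\<^sup>2)) (at t)"
      using d\<alpha>[of t] by (simp add: derivs rho)
    show "((\<lambda>s. - \<beta> s) has_real_derivative - \<kappa>\<^sub>b * (sigma (deriv A (r t)) / (- (t - r t))\<^sup>2)) (at t)"
      using DERIV_minus[OF d\<beta>[of t]] by (simp add: derivs power2_commute)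
  qed auto
  then show ?thesis
    using smooth init v0 derivs by (metis (no_types, lifting) b_def minus_minus)
qed

end
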